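(* Let $H$ be an arbitrary Hopf algebra over a field of characteristic $0$ and let $B$ be a finite dimensional semisimple Lie algebra over this field that is an $H$-comodule Lie algebra. Then $B=B_1\oplus B_2\oplus\dots\oplus B_s$ (direct sum of ideals of $B$ that are $H$-subcomodules) for some $H$-simple subalgebras $B_i$.
   Context: A Lie algebra $L$ that is a right $H$-comodule via $\rho\colon L\to L\otimes H$, written in Sweedler notation $\rho(a)=a_{(0)}\otimes a_{(1)}$, is an $H$-comodule Lie algebra if $\rho([a,b])=[a_{(0)},b_{(0)}]\otimes a_{(1)}b_{(1)}$ for all $a,b\in L$. A subspace $W\subseteq L$ is an $H$-subcomodule if $\rho(W)\subseteq W\otimes H$. An $H$-comodule Lie algebra $B$ is $H$-simple if for every ideal $I$ of $B$ that is an $H$-subcomodule, either $I=0$ or $I=B$. *)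

theory Defs
  imports Complex_Main "HOL-Library.FuncSet" "HOL-Library.Poly_Mapping"
begin

section \<open>Bilinear maps and formal linear combinations\<close>

definition bilinear_map ::
  "('k::field \<Rightarrow> 'v::ab_group_add \<Rightarrow> 'v) \<Rightarrow> ('k \<Rightarrow> 'w::ab_group_add \<Rightarrow> 'w) \<Rightarrow>
   ('k \<Rightarrow> 'u::ab_group_add \<Rightarrow> 'u) \<Rightarrow> ('v \<Rightarrow> 'w \<Rightarrow> 'u) \<Rightarrow> bool"
  where "bilinear_map sV sW sU \<beta> \<longleftrightarrow>
    (\<forall>v. Vector_Spaces.linear sW sU (\<beta> v)) \<and>
    (\<forall>w. Vector_Spaces.linear sV sU (\<lambda>v. \<beta> v w))"

text \<open>The free vector space on a set of generators of type \<open>'i\<close> is \<^typ>\<open>'i \<Rightarrow>\<^sub>0 'k\<close>.\<close>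

definition formal_scale :: "'k::field \<Rightarrow> ('i \<Rightarrow>\<^sub>0 'k) \<Rightarrow> ('i \<Rightarrow>\<^sub>0 'k)"
  where "formal_scale c x = Poly_Mapping.map (\<lambda>a. c * a) x"

abbreviation gen :: "'i \<Rightarrow> ('i \<Rightarrow>\<^sub>0 'k::field)"
  where "gen i \<equiv> Poly_Mapping.single i 1"

definition formal_extend ::
  "('k::field \<Rightarrow> 'u::ab_group_add \<Rightarrow> 'u) \<Rightarrow> ('i \<Rightarrow> 'u) \<Rightarrow> ('i \<Rightarrow>\<^sub>0 'k) \<Rightarrow> 'u"
  where "formal_extend s f x = (\<Sum>i\<in>Poly_Mapping.keys x. s (Poly_Mapping.lookup x i) (f i))"

lemma lookup_formal_scale [simp]:
  "Poly_Mapping.lookup (formal_scale c x) i = c * Poly_Mapping.lookup x i"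
  by (simp add: formal_scale_def Poly_Mapping.map.rep_eq when_def)

lemma vector_space_formal_scale: "vector_space formal_scale"
  by unfold_locales
    (auto intro!: poly_mapping_eqI simp: lookup_add algebra_simps)

interpretation formal: vector_space formal_scale
  by (rule vector_space_formal_scale)


section \<open>Tensor products\<close>

text \<open>\<open>V \<otimes> W\<close> is the free vector space on \<open>V \<times> W\<close> modulo the span of the bilinearity relations;
  its elements are cosets, and operations on them are defined through representatives.
  The lemmas ending in \<open>_class\<close> show that the choice of representatives is immaterial.\<close>

type_synonym ('v, 'w, 'k) tensor = "('v \<times> 'w \<Rightarrow>\<^sub>0 'k) set"

definition tensor_relators ::
  "('k::field \<Rightarrow> 'v::ab_group_add \<Rightarrow> 'v) \<Rightarrow> ('k \<Rightarrow> 'w::ab_group_add \<Rightarrow> 'w) \<Rightarrow> ('v \<times> 'w \<Rightarrow>\<^sub>0 'k) set"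
  where "tensor_relators sV sW =
      {gen (v + v', w) - gen (v, w) - gen (v', w) | v v' w. True}
    \<union> {gen (v, w + w') - gen (v, w) - gen (v, w') | v w w'. True}
    \<union> {gen (sV c v, w) - formal_scale c (gen (v, w)) | c v w. True}
    \<union> {gen (v, sW c w) - formal_scale c (gen (v, w)) | c v w. True}"

definition tensor_null ::
  "('k::field \<Rightarrow> 'v::ab_group_add \<Rightarrow> 'v) \<Rightarrow> ('k \<Rightarrow> 'w::ab_group_add \<Rightarrow> 'w) \<Rightarrow> ('v \<times> 'w \<Rightarrow>\<^sub>0 'k) set"
  where "tensor_null sV sW = formal.span (tensor_relators sV sW)"

definition tensor_class ::
  "('k::field \<Rightarrow> 'v::ab_group_add \<Rightarrow> 'v) \<Rightarrow> ('k \<Rightarrow> 'w::ab_group_add \<Rightarrow> 'w) \<Rightarrow>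
   ('v \<times> 'w \<Rightarrow>\<^sub>0 'k) \<Rightarrow> ('v, 'w, 'k) tensor"
  where "tensor_class sV sW x = {y. y - x \<in> tensor_null sV sW}"

definition tensor_space ::
  "('k::field \<Rightarrow> 'v::ab_group_add \<Rightarrow> 'v) \<Rightarrow> ('k \<Rightarrow> 'w::ab_group_add \<Rightarrow> 'w) \<Rightarrow> ('v, 'w, 'k) tensor set"
  where "tensor_space sV sW = range (tensor_class sV sW)"

definition pure_tensor ::
  "('k::field \<Rightarrow> 'v::ab_group_add \<Rightarrow> 'v) \<Rightarrow> ('k \<Rightarrow> 'w::ab_group_add \<Rightarrow> 'w) \<Rightarrow>
   'v \<Rightarrow> 'w \<Rightarrow> ('v, 'w, 'k) tensor"
  where "pure_tensor sV sW v w = tensor_class sV sW (gen (v, w))"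

definition tensor_rep :: "('v, 'w, 'k::field) tensor \<Rightarrow> ('v \<times> 'w \<Rightarrow>\<^sub>0 'k)"
  where "tensor_rep X = (SOME x. x \<in> X)"

definition tensor_add ::
  "('k::field \<Rightarrow> 'v::ab_group_add \<Rightarrow> 'v) \<Rightarrow> ('k \<Rightarrow> 'w::ab_group_add \<Rightarrow> 'w) \<Rightarrow>
   ('v, 'w, 'k) tensor \<Rightarrow> ('v, 'w, 'k) tensor \<Rightarrow> ('v, 'w, 'k) tensor"
  where "tensor_add sV sW X Y = tensor_class sV sW (tensor_rep X + tensor_rep Y)"

definition tensor_scale ::
  "('k::field \<Rightarrow> 'v::ab_group_add \<Rightarrow> 'v) \<Rightarrow> ('k \<Rightarrow> 'w::ab_group_add \<Rightarrow> 'w) \<Rightarrow>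
   'k \<Rightarrow> ('v, 'w, 'k) tensor \<Rightarrow> ('v, 'w, 'k) tensor"
  where "tensor_scale sV sW c X = tensor_class sV sW (formal_scale c (tensor_rep X))"

text \<open>The image of \<open>A \<otimes> C\<close> in \<open>V \<otimes> W\<close> for subspaces \<open>A\<close> of \<open>V\<close> and \<open>C\<close> of \<open>W\<close>.\<close>

definition tensor_subspace ::
  "('k::field \<Rightarrow> 'v::ab_group_add \<Rightarrow> 'v) \<Rightarrow> ('k \<Rightarrow> 'w::ab_group_add \<Rightarrow> 'w) \<Rightarrow>
   'v set \<Rightarrow> 'w set \<Rightarrow> ('v, 'w, 'k) tensor set"
  where "tensor_subspace sV sW A C = tensor_class sV sW ` {x. Poly_Mapping.keys x \<subseteq> A \<times> C}"

text \<open>Linear maps from \<open>U\<close> to \<open>V \<otimes> W\<close>, and the linear map \<open>v \<otimes> w \<mapsto> \<beta> v w\<close> from \<open>V \<otimes> W\<close> to \<open>U\<close>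
  induced by a bilinear map \<open>\<beta>\<close>.\<close>

definition linear_into_tensor ::
  "('k::field \<Rightarrow> 'u::ab_group_add \<Rightarrow> 'u) \<Rightarrow> ('k \<Rightarrow> 'v::ab_group_add \<Rightarrow> 'v) \<Rightarrow>
   ('k \<Rightarrow> 'w::ab_group_add \<Rightarrow> 'w) \<Rightarrow> ('u \<Rightarrow> ('v, 'w, 'k) tensor) \<Rightarrow> bool"
  where "linear_into_tensor sU sV sW f \<longleftrightarrow>
    (\<forall>u. f u \<in> tensor_space sV sW) \<and>
    (\<forall>u u'. f (u + u') = tensor_add sV sW (f u) (f u')) \<and>
    (\<forall>c u. f (sU c u) = tensor_scale sV sW c (f u))"

definition tensor_lift ::
  "('k::field \<Rightarrow> 'u::ab_group_add \<Rightarrow> 'u) \<Rightarrow> ('v \<Rightarrow> 'w \<Rightarrow> 'u) \<Rightarrow> ('v, 'w, 'k) tensor \<Rightarrow> 'u"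
  where "tensor_lift sU \<beta> X = formal_extend sU (\<lambda>(v, w). \<beta> v w) (tensor_rep X)"

text \<open>The componentwise product \<open>(v \<otimes> w) (v' \<otimes> w') = m v v' \<otimes> n w w'\<close>.\<close>

definition formal_mult ::
  "('v \<Rightarrow> 'v \<Rightarrow> 'v) \<Rightarrow> ('w \<Rightarrow> 'w \<Rightarrow> 'w) \<Rightarrow>
   ('v \<times> 'w \<Rightarrow>\<^sub>0 'k::field) \<Rightarrow> ('v \<times> 'w \<Rightarrow>\<^sub>0 'k) \<Rightarrow> ('v \<times> 'w \<Rightarrow>\<^sub>0 'k)"
  where "formal_mult m n x y =
    formal_extend formal_scale (\<lambda>(v, w).
      formal_extend formal_scale (\<lambda>(v', w'). gen (m v v', n w w')) y) x"

definition tensor_mult ::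
  "('k::field \<Rightarrow> 'v::ab_group_add \<Rightarrow> 'v) \<Rightarrow> ('k \<Rightarrow> 'w::ab_group_add \<Rightarrow> 'w) \<Rightarrow>
   ('v \<Rightarrow> 'v \<Rightarrow> 'v) \<Rightarrow> ('w \<Rightarrow> 'w \<Rightarrow> 'w) \<Rightarrow>
   ('v, 'w, 'k) tensor \<Rightarrow> ('v, 'w, 'k) tensor \<Rightarrow> ('v, 'w, 'k) tensor"
  where "tensor_mult sV sW m n X Y =
    tensor_class sV sW (formal_mult m n (tensor_rep X) (tensor_rep Y))"

text \<open>Threefold tensor products.\<close>

type_synonym ('u, 'v, 'w, 'k) tensor3 = "('u \<times> 'v \<times> 'w \<Rightarrow>\<^sub>0 'k) set"

definition tensor3_relators ::
  "('k::field \<Rightarrow> 'u::ab_group_add \<Rightarrow> 'u) \<Rightarrow> ('k \<Rightarrow> 'v::ab_group_add \<Rightarrow> 'v) \<Rightarrow>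
   ('k \<Rightarrow> 'w::ab_group_add \<Rightarrow> 'w) \<Rightarrow> ('u \<times> 'v \<times> 'w \<Rightarrow>\<^sub>0 'k) set"
  where "tensor3_relators sU sV sW =
      {gen (u + u', v, w) - gen (u, v, w) - gen (u', v, w) | u u' v w. True}
    \<union> {gen (u, v + v', w) - gen (u, v, w) - gen (u, v', w) | u v v' w. True}
    \<union> {gen (u, v, w + w') - gen (u, v, w) - gen (u, v, w') | u v w w'. True}
    \<union> {gen (sU c u, v, w) - formal_scale c (gen (u, v, w)) | c u v w. True}
    \<union> {gen (u, sV c v, w) - formal_scale c (gen (u, v, w)) | c u v w. True}
    \<union> {gen (u, v, sW c w) - formal_scale c (gen (u, v, w)) | c u v w. True}"

definition tensor3_null ::
  "('k::field \<Rightarrow> 'u::ab_group_add \<Rightarrow> 'u) \<Rightarrow> ('k \<Rightarrow> 'v::ab_group_add \<Rightarrow> 'v) \<Rightarrow>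
   ('k \<Rightarrow> 'w::ab_group_add \<Rightarrow> 'w) \<Rightarrow> ('u \<times> 'v \<times> 'w \<Rightarrow>\<^sub>0 'k) set"
  where "tensor3_null sU sV sW = formal.span (tensor3_relators sU sV sW)"

definition tensor3_class ::
  "('k::field \<Rightarrow> 'u::ab_group_add \<Rightarrow> 'u) \<Rightarrow> ('k \<Rightarrow> 'v::ab_group_add \<Rightarrow> 'v) \<Rightarrow>
   ('k \<Rightarrow> 'w::ab_group_add \<Rightarrow> 'w) \<Rightarrow> ('u \<times> 'v \<times> 'w \<Rightarrow>\<^sub>0 'k) \<Rightarrow> ('u, 'v, 'w, 'k) tensor3"
  where "tensor3_class sU sV sW x = {y. y - x \<in> tensor3_null sU sV sW}"

text \<open>\<open>map_left\<close> is \<open>f \<otimes> id\<close> for \<open>f\<close> from \<open>A\<close> to \<open>U \<otimes> V\<close>, as a map from \<open>A \<otimes> W\<close> to \<open>U \<otimes> V \<otimes> W\<close>;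
  \<open>map_right\<close> is \<open>id \<otimes> g\<close> for \<open>g\<close> from \<open>C\<close> to \<open>V \<otimes> W\<close>, as a map from \<open>U \<otimes> C\<close> to \<open>U \<otimes> V \<otimes> W\<close>.\<close>

definition formal_map_left ::
  "('a \<Rightarrow> ('u, 'v, 'k::field) tensor) \<Rightarrow> ('a \<times> 'w \<Rightarrow>\<^sub>0 'k) \<Rightarrow> ('u \<times> 'v \<times> 'w \<Rightarrow>\<^sub>0 'k)"
  where "formal_map_left f = formal_extend formal_scale (\<lambda>(a, w).
    formal_extend formal_scale (\<lambda>(u, v). gen (u, v, w)) (tensor_rep (f a)))"

definition formal_map_right ::
  "('c \<Rightarrow> ('v, 'w, 'k::field) tensor) \<Rightarrow> ('u \<times> 'c \<Rightarrow>\<^sub>0 'k) \<Rightarrow> ('u \<times> 'v \<times> 'w \<Rightarrow>\<^sub>0 'k)"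
  where "formal_map_right g = formal_extend formal_scale (\<lambda>(u, c).
    formal_extend formal_scale (\<lambda>(v, w). gen (u, v, w)) (tensor_rep (g c)))"

definition map_left ::
  "('k::field \<Rightarrow> 'u::ab_group_add \<Rightarrow> 'u) \<Rightarrow> ('k \<Rightarrow> 'v::ab_group_add \<Rightarrow> 'v) \<Rightarrow>
   ('k \<Rightarrow> 'w::ab_group_add \<Rightarrow> 'w) \<Rightarrow> ('a \<Rightarrow> ('u, 'v, 'k) tensor) \<Rightarrow>
   ('a, 'w, 'k) tensor \<Rightarrow> ('u, 'v, 'w, 'k) tensor3"
  where "map_left sU sV sW f X = tensor3_class sU sV sW (formal_map_left f (tensor_rep X))"

definition map_right ::
  "('k::field \<Rightarrow> 'u::ab_group_add \<Rightarrow> 'u) \<Rightarrow> ('k \<Rightarrow> 'v::ab_group_add \<Rightarrow> 'v) \<Rightarrow>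
   ('k \<Rightarrow> 'w::ab_group_add \<Rightarrow> 'w) \<Rightarrow> ('c \<Rightarrow> ('v, 'w, 'k) tensor) \<Rightarrow>
   ('u, 'c, 'k) tensor \<Rightarrow> ('u, 'v, 'w, 'k) tensor3"
  where "map_right sU sV sW g X = tensor3_class sU sV sW (formal_map_right g (tensor_rep X))"


subsection \<open>Independence of representatives\<close>

lemma (in vector_space) formal_extend_superset:
  assumes "finite K" "Poly_Mapping.keys x \<subseteq> K"
  shows "formal_extend scale f x = (\<Sum>i\<in>K. scale (Poly_Mapping.lookup x i) (f i))"
  unfolding formal_extend_def
  using assms by (intro sum.mono_neutral_left) (auto simp: in_keys_iff)

lemma linear_hom: "Vector_Spaces.linear s t f \<Longrightarrow> module_hom s t f"
  by (simp add: Vector_Spaces.linear_def)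

lemma (in vector_space) linear_formal_extend:
  "Vector_Spaces.linear formal_scale scale (formal_extend scale f)"
proof -
  have "formal_extend scale f (x + y) = formal_extend scale f x + formal_extend scale f y" for x y
  proof -
    let ?K = "Poly_Mapping.keys x \<union> Poly_Mapping.keys y"
    have "Poly_Mapping.keys (x + y) \<subseteq> ?K" by (rule keys_add)
    then show ?thesis
      by (simp add: formal_extend_superset[of ?K] lookup_add scale_left_distrib sum.distrib)
  qed
  moreover have "formal_extend scale f (formal_scale c x) = scale c (formal_extend scale f x)" for c x
  proof -
    have "Poly_Mapping.keys (formal_scale c x) \<subseteq> Poly_Mapping.keys x"
      by (auto simp: in_keys_iff)
    then show ?thesis
      by (simp add: formal_extend_superset[of "Poly_Mapping.keys x"] scale_sum_right)
  qed
  ultimately show ?thesis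
    by (simp add: Vector_Spaces.linear_def module_hom_def module_hom_axioms_def
        vector_space_formal_scale vector_space_axioms formal.module_axioms module_axioms)
qed

lemma (in vector_space) formal_extend_gen [simp]: "formal_extend scale f (gen i) = f i"
  by (simp add: formal_extend_def)

lemma (in vector_space) formal_extend_add_fun:
  "formal_extend scale (\<lambda>i. f i + g i) x = formal_extend scale f x + formal_extend scale g x"
  by (simp add: formal_extend_def scale_right_distrib sum.distrib)

lemma (in vector_space) formal_extend_diff_fun:
  "formal_extend scale (\<lambda>i. f i - g i) x = formal_extend scale f x - formal_extend scale g x"
  by (simp add: formal_extend_def scale_right_diff_distrib sum_subtractf)

lemma (in vector_space) formal_extend_scale_fun:
  "formal_extend scale (\<lambda>i. scale c (f i)) x = scale c (formal_extend scale f x)"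
  by (simp add: formal_extend_def scale_sum_right mult.commute)

lemma (in vector_space) formal_extend_in_subspace:
  "subspace T \<Longrightarrow> (\<And>i. f i \<in> T) \<Longrightarrow> formal_extend scale f x \<in> T"
  unfolding formal_extend_def by (intro subspace_sum subspace_scale)

lemmas formal_linear = formal.linear_formal_extend

lemmas formal_extend_simps =
  module_hom.add[OF linear_hom[OF formal_linear]]
  module_hom.diff[OF linear_hom[OF formal_linear]]
  module_hom.scale[OF linear_hom[OF formal_linear]]

lemma tensor_relators_mem:
  "gen (v + v', w) - gen (v, w) - gen (v', w) \<in> tensor_null sV sW"
  "gen (v, w + w') - gen (v, w) - gen (v, w') \<in> tensor_null sV sW"
  "gen (sV c v, w) - formal_scale c (gen (v, w)) \<in> tensor_null sV sW"
  "gen (v, sW c w) - formal_scale c (gen (v, w)) \<in> tensor_null sV sW"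
  unfolding tensor_null_def
  by (rule formal.span_base; unfold tensor_relators_def; blast)+

lemma tensor3_relators_mem:
  "gen (u + u', v, w) - gen (u, v, w) - gen (u', v, w) \<in> tensor3_null sU sV sW"
  "gen (u, v + v', w) - gen (u, v, w) - gen (u, v', w) \<in> tensor3_null sU sV sW"
  "gen (u, v, w + w') - gen (u, v, w) - gen (u, v, w') \<in> tensor3_null sU sV sW"
  "gen (sU c u, v, w) - formal_scale c (gen (u, v, w)) \<in> tensor3_null sU sV sW"
  "gen (u, sV c v, w) - formal_scale c (gen (u, v, w)) \<in> tensor3_null sU sV sW"
  "gen (u, v, sW c w) - formal_scale c (gen (u, v, w)) \<in> tensor3_null sU sV sW"
  unfolding tensor3_null_def tensor3_relators_def
  by - (rule formal.span_base, (rule UnI1 UnI2)+, rule CollectI,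
    (rule exI)+, rule conjI, rule refl, rule TrueI)+

lemma subspace_tensor_null: "formal.subspace (tensor_null sV sW)"
  by (simp add: tensor_null_def)

lemma subspace_tensor3_null: "formal.subspace (tensor3_null sU sV sW)"
  by (simp add: tensor3_null_def)

lemma coset_eq_iff:
  assumes "formal.subspace N"
  shows "{z. z - x \<in> N} = {z. z - y \<in> N} \<longleftrightarrow> x - y \<in> N"
proof
  assume "{z. z - x \<in> N} = {z. z - y \<in> N}"
  moreover have "x \<in> {z. z - x \<in> N}"
    using formal.subspace_0[OF assms] by simp
  ultimately show "x - y \<in> N" by blast
next
  assume d: "x - y \<in> N"
  have "z - x \<in> N \<longleftrightarrow> z - y \<in> N" for z
    using formal.subspace_add[OF assms _ d, of "z - x"]
      formal.subspace_diff[OF assms _ d, of "z - y"] by auto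
  then show "{z. z - x \<in> N} = {z. z - y \<in> N}" by blast
qed

lemma tensor_class_eq_iff:
  "tensor_class sV sW x = tensor_class sV sW y \<longleftrightarrow> x - y \<in> tensor_null sV sW"
  unfolding tensor_class_def by (rule coset_eq_iff[OF subspace_tensor_null])

lemma tensor3_class_eq_iff:
  "tensor3_class sU sV sW x = tensor3_class sU sV sW y \<longleftrightarrow> x - y \<in> tensor3_null sU sV sW"
  unfolding tensor3_class_def by (rule coset_eq_iff[OF subspace_tensor3_null])

lemma tensor_rep_class: "tensor_rep (tensor_class sV sW x) - x \<in> tensor_null sV sW"
proof -
  have "x \<in> tensor_class sV sW x"
    using formal.subspace_0[OF subspace_tensor_null] by (simp add: tensor_class_def)
  then have "tensor_rep (tensor_class sV sW x) \<in> tensor_class sV sW x"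
    unfolding tensor_rep_def by (rule someI)
  then show ?thesis by (simp add: tensor_class_def)
qed

lemma class_tensor_rep: "X \<in> tensor_space sV sW \<Longrightarrow> tensor_class sV sW (tensor_rep X) = X"
  unfolding tensor_space_def by clarify (simp only: tensor_class_eq_iff tensor_rep_class)

lemma tensor_add_class:
  "tensor_add sV sW (tensor_class sV sW x) (tensor_class sV sW y) = tensor_class sV sW (x + y)"
  unfolding tensor_add_def tensor_class_eq_iff
  using formal.subspace_add[OF subspace_tensor_null tensor_rep_class tensor_rep_class,
      of sV sW x y]
  by (simp add: algebra_simps)

lemma tensor_scale_class:
  "tensor_scale sV sW c (tensor_class sV sW x) = tensor_class sV sW (formal_scale c x)"
  unfolding tensor_scale_def tensor_class_eq_iff
  using formal.subspace_scale[OF subspace_tensor_null tensor_rep_class, of c sV sW x]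
  by (simp add: formal.scale_right_diff_distrib)

lemma pure_tensor_bilinear:
  "pure_tensor sV sW (v + v') w = tensor_add sV sW (pure_tensor sV sW v w) (pure_tensor sV sW v' w)"
  "pure_tensor sV sW v (w + w') = tensor_add sV sW (pure_tensor sV sW v w) (pure_tensor sV sW v w')"
  "pure_tensor sV sW (sV c v) w = tensor_scale sV sW c (pure_tensor sV sW v w)"
  "pure_tensor sV sW v (sW c w) = tensor_scale sV sW c (pure_tensor sV sW v w)"
  using tensor_relators_mem[where sV = sV and sW = sW]
  by (simp_all add: pure_tensor_def tensor_add_class tensor_scale_class tensor_class_eq_iff
      diff_diff_eq)

lemma tensor_null_induct:
  assumes hom: "module_hom formal_scale s F"
    and T: "module.subspace s T"
    and "\<And>v v' w. F (gen (v + v', w)) - F (gen (v, w)) - F (gen (v', w)) \<in> T"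
    and "\<And>v w w'. F (gen (v, w + w')) - F (gen (v, w)) - F (gen (v, w')) \<in> T"
    and "\<And>c v w. F (gen (sV c v, w)) - s c (F (gen (v, w))) \<in> T"
    and "\<And>c v w. F (gen (v, sW c w)) - s c (F (gen (v, w))) \<in> T"
    and x: "x \<in> tensor_null sV sW"
  shows "F x \<in> T"
proof -
  interpret F: module_hom formal_scale s F by (rule hom)
  have "tensor_relators sV sW \<subseteq> F -` T"
    unfolding tensor_relators_def using assms(3-6) by (auto simp: F.diff F.scale)
  moreover have "formal.subspace (F -` T)"
    using F.subspace_vimage[OF T] .
  ultimately have "tensor_null sV sW \<subseteq> F -` T"
    unfolding tensor_null_def by (rule formal.span_minimal)
  then show ?thesis using x by auto
qed

lemma tensor_lift_class:
  assumes "bilinear_map sV sW sU \<beta>"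
  shows "tensor_lift sU \<beta> (tensor_class sV sW x) = formal_extend sU (\<lambda>(v, w). \<beta> v w) x"
proof -
  have l1: "Vector_Spaces.linear sW sU (\<beta> v)"
    and l2: "Vector_Spaces.linear sV sU (\<lambda>v. \<beta> v w)" for v w
    using assms by (auto simp: bilinear_map_def)
  note b = module_hom.add[OF linear_hom[OF l1]] module_hom.scale[OF linear_hom[OF l1]]
    module_hom.add[OF linear_hom[OF l2]] module_hom.scale[OF linear_hom[OF l2]]
  interpret U: vector_space sU using l1 by (simp add: Vector_Spaces.linear_def)
  let ?F = "formal_extend sU (\<lambda>(v, w). \<beta> v w)"
  have hom: "module_hom formal_scale sU ?F"
    by (rule linear_hom[OF U.linear_formal_extend])
  have "?F (tensor_rep (tensor_class sV sW x) - x) \<in> {0}"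
    by (rule tensor_null_induct[OF hom U.subspace_single_0 _ _ _ _ tensor_rep_class]) (auto simp: b)
  then show ?thesis
    by (simp add: tensor_lift_def module_hom.diff[OF hom])
qed

lemma formal_mult_swap:
  "formal_mult m n x y =
    formal_extend formal_scale (\<lambda>(v', w').
      formal_extend formal_scale (\<lambda>(v, w). gen (m v v', n w w')) x) y"
  unfolding formal_mult_def formal_extend_def
  by (simp add: formal.scale_sum_right case_prod_beta,
      subst sum.swap, simp add: mult.commute)

lemma bilinear_relators:
  assumes m: "bilinear_map sV sV sV m" and n: "bilinear_map sW sW sW n"
  shows "gen (m (v + v') b, n w h) - gen (m v b, n w h) - gen (m v' b, n w h) \<in> tensor_null sV sW"
    "gen (m v b, n (w + w') h) - gen (m v b, n w h) - gen (m v b, n w' h) \<in> tensor_null sV sW"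
    "gen (m (sV c v) b, n w h) - formal_scale c (gen (m v b, n w h)) \<in> tensor_null sV sW"
    "gen (m v b, n (sW c w) h) - formal_scale c (gen (m v b, n w h)) \<in> tensor_null sV sW"
    "gen (m b (v + v'), n h w) - gen (m b v, n h w) - gen (m b v', n h w) \<in> tensor_null sV sW"
    "gen (m b v, n h (w + w')) - gen (m b v, n h w) - gen (m b v, n h w') \<in> tensor_null sV sW"
    "gen (m b (sV c v), n h w) - formal_scale c (gen (m b v, n h w)) \<in> tensor_null sV sW"
    "gen (m b v, n h (sW c w)) - formal_scale c (gen (m b v, n h w)) \<in> tensor_null sV sW"
proof -
  have l: "Vector_Spaces.linear sV sV (m v)" "Vector_Spaces.linear sV sV (\<lambda>v. m v b)"
    "Vector_Spaces.linear sW sW (n w)" "Vector_Spaces.linear sW sW (\<lambda>w. n w h)" for v b w h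
    using m n by (auto simp: bilinear_map_def)
  note [simp] = module_hom.add[OF linear_hom[OF l(1)]] module_hom.scale[OF linear_hom[OF l(1)]]
    module_hom.add[OF linear_hom[OF l(2)]] module_hom.scale[OF linear_hom[OF l(2)]]
    module_hom.add[OF linear_hom[OF l(3)]] module_hom.scale[OF linear_hom[OF l(3)]]
    module_hom.add[OF linear_hom[OF l(4)]] module_hom.scale[OF linear_hom[OF l(4)]]
  show "gen (m (v + v') b, n w h) - gen (m v b, n w h) - gen (m v' b, n w h) \<in> tensor_null sV sW"
    "gen (m v b, n (w + w') h) - gen (m v b, n w h) - gen (m v b, n w' h) \<in> tensor_null sV sW"
    "gen (m (sV c v) b, n w h) - formal_scale c (gen (m v b, n w h)) \<in> tensor_null sV sW"
    "gen (m v b, n (sW c w) h) - formal_scale c (gen (m v b, n w h)) \<in> tensor_null sV sW"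
    "gen (m b (v + v'), n h w) - gen (m b v, n h w) - gen (m b v', n h w) \<in> tensor_null sV sW"
    "gen (m b v, n h (w + w')) - gen (m b v, n h w) - gen (m b v, n h w') \<in> tensor_null sV sW"
    "gen (m b (sV c v), n h w) - formal_scale c (gen (m b v, n h w)) \<in> tensor_null sV sW"
    "gen (m b v, n h (sW c w)) - formal_scale c (gen (m b v, n h w)) \<in> tensor_null sV sW"
    by (simp_all add: tensor_relators_mem)
qed

lemma tensor_mult_class:
  assumes m: "bilinear_map sV sV sV m" and n: "bilinear_map sW sW sW n"
  shows "tensor_mult sV sW m n (tensor_class sV sW x) (tensor_class sV sW y) =
    tensor_class sV sW (formal_mult m n x y)"
proof -
  let ?N = "tensor_null sV sW"
  let ?x = "tensor_rep (tensor_class sV sW x)" and ?y = "tensor_rep (tensor_class sV sW y)"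
  have left: "formal_mult m n z y' \<in> ?N" if "z \<in> ?N" for z y'
    unfolding formal_mult_def
    by (rule tensor_null_induct[OF linear_hom[OF formal_linear] subspace_tensor_null _ _ _ _ that])
      (auto simp: formal.formal_extend_diff_fun[symmetric] formal.formal_extend_scale_fun[symmetric]
        bilinear_relators[OF m n]
        intro!: formal.formal_extend_in_subspace[OF subspace_tensor_null])
  have right: "formal_mult m n x' z \<in> ?N" if "z \<in> ?N" for z x'
    unfolding formal_mult_swap
    by (rule tensor_null_induct[OF linear_hom[OF formal_linear] subspace_tensor_null _ _ _ _ that])
      (auto simp: formal.formal_extend_diff_fun[symmetric] formal.formal_extend_scale_fun[symmetric]
        bilinear_relators[OF m n]
        intro!: formal.formal_extend_in_subspace[OF subspace_tensor_null])
  have "formal_mult m n ?x ?y - formal_mult m n x y =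
      formal_mult m n (?x - x) ?y + formal_mult m n x (?y - y)"
  proof -
    have "formal_mult m n (?x - x) ?y = formal_mult m n ?x ?y - formal_mult m n x ?y"
      unfolding formal_mult_def by (rule formal_extend_simps)
    moreover have "formal_mult m n x (?y - y) = formal_mult m n x ?y - formal_mult m n x y"
      unfolding formal_mult_swap by (rule formal_extend_simps)
    ultimately show ?thesis by simp
  qed
  then show ?thesis
    unfolding tensor_mult_def tensor_class_eq_iff
    using formal.subspace_add[OF subspace_tensor_null left[OF tensor_rep_class] right[OF tensor_rep_class]]
    by simp
qed

lemma map_left_class:
  assumes f: "linear_into_tensor sA sU sV f"
  shows "map_left sU sV sW f (tensor_class sA sW x) = tensor3_class sU sV sW (formal_map_left f x)"
proof -
  let ?N = "tensor3_null sU sV sW"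
  let ?g = "\<lambda>w. formal_extend formal_scale (\<lambda>(u, v). gen (u, v, w))"
  have null: "?g w z \<in> ?N" if "z \<in> tensor_null sU sV" for z w
    by (rule tensor_null_induct[OF linear_hom[OF formal_linear] subspace_tensor3_null _ _ _ _ that])
      (auto simp: tensor3_relators_mem)
  have add: "tensor_rep (f (a + a')) - tensor_rep (f a) - tensor_rep (f a') \<in> tensor_null sU sV" for a a'
    using f tensor_rep_class[of sU sV "tensor_rep (f a) + tensor_rep (f a')"]
    by (simp add: linear_into_tensor_def tensor_add_def diff_diff_eq)
  have sc: "tensor_rep (f (sA c a)) - formal_scale c (tensor_rep (f a)) \<in> tensor_null sU sV" for c a
    using f tensor_rep_class[of sU sV "formal_scale c (tensor_rep (f a))"]
    by (simp add: linear_into_tensor_def tensor_scale_def)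
  have "formal_map_left f (tensor_rep (tensor_class sA sW x) - x) \<in> ?N"
    unfolding formal_map_left_def
    by (rule tensor_null_induct[OF linear_hom[OF formal_linear] subspace_tensor3_null _ _ _ _ tensor_rep_class])
      (use null[OF add] null[OF sc] in
       \<open>auto simp: formal_extend_simps formal.formal_extend_diff_fun[symmetric]
          formal.formal_extend_scale_fun[symmetric] tensor3_relators_mem
          intro!: formal.formal_extend_in_subspace[OF subspace_tensor3_null]\<close>)
  then show ?thesis
    by (simp add: map_left_def tensor3_class_eq_iff formal_map_left_def formal_extend_simps)
qed

lemma map_right_class:
  assumes g: "linear_into_tensor sC sV sW g"
  shows "map_right sU sV sW g (tensor_class sU sC x) = tensor3_class sU sV sW (formal_map_right g x)"
proof -
  let ?N = "tensor3_null sU sV sW"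
  let ?g = "\<lambda>u. formal_extend formal_scale (\<lambda>(v, w). gen (u, v, w))"
  have null: "?g u z \<in> ?N" if "z \<in> tensor_null sV sW" for z u
    by (rule tensor_null_induct[OF linear_hom[OF formal_linear] subspace_tensor3_null _ _ _ _ that])
      (auto simp: tensor3_relators_mem)
  have add: "tensor_rep (g (a + a')) - tensor_rep (g a) - tensor_rep (g a') \<in> tensor_null sV sW" for a a'
    using g tensor_rep_class[of sV sW "tensor_rep (g a) + tensor_rep (g a')"]
    by (simp add: linear_into_tensor_def tensor_add_def diff_diff_eq)
  have sc: "tensor_rep (g (sC c a)) - formal_scale c (tensor_rep (g a)) \<in> tensor_null sV sW" for c a
    using g tensor_rep_class[of sV sW "formal_scale c (tensor_rep (g a))"]
    by (simp add: linear_into_tensor_def tensor_scale_def)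
  have "formal_map_right g (tensor_rep (tensor_class sU sC x) - x) \<in> ?N"
    unfolding formal_map_right_def
    by (rule tensor_null_induct[OF linear_hom[OF formal_linear] subspace_tensor3_null _ _ _ _ tensor_rep_class])
      (use null[OF add] null[OF sc] in
       \<open>auto simp: formal_extend_simps formal.formal_extend_diff_fun[symmetric]
          formal.formal_extend_scale_fun[symmetric] tensor3_relators_mem
          intro!: formal.formal_extend_in_subspace[OF subspace_tensor3_null]\<close>)
  then show ?thesis
    by (simp add: map_right_def tensor3_class_eq_iff formal_map_right_def formal_extend_simps)
qed


section \<open>Hopf algebras\<close>

locale hopf_algebra = vector_space sH
  for sH :: "'k::field \<Rightarrow> 'h::ring_1 \<Rightarrow> 'h" +
  fixes \<Delta> :: "'h \<Rightarrow> ('h, 'h, 'k) tensor"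
    and \<epsilon> :: "'h \<Rightarrow> 'k"
    and S :: "'h \<Rightarrow> 'h"
  assumes mult_bilinear: "bilinear_map sH sH sH (*)"
    and comult_linear: "linear_into_tensor sH sH sH \<Delta>"
    and counit_linear: "Vector_Spaces.linear sH (*) \<epsilon>"
    and antipode_linear: "Vector_Spaces.linear sH sH S"
    and comult_coassoc: "map_left sH sH sH \<Delta> (\<Delta> h) = map_right sH sH sH \<Delta> (\<Delta> h)"
    and counit_left: "tensor_lift sH (\<lambda>g g'. sH (\<epsilon> g) g') (\<Delta> h) = h"
    and counit_right: "tensor_lift sH (\<lambda>g g'. sH (\<epsilon> g') g) (\<Delta> h) = h"
    and comult_mult: "\<Delta> (g * h) = tensor_mult sH sH (*) (*) (\<Delta> g) (\<Delta> h)"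
    and comult_one: "\<Delta> 1 = pure_tensor sH sH 1 1"
    and counit_mult: "\<epsilon> (g * h) = \<epsilon> g * \<epsilon> h"
    and counit_one: "\<epsilon> 1 = 1"
    and antipode_left: "tensor_lift sH (\<lambda>g g'. S g * g') (\<Delta> h) = sH (\<epsilon> h) 1"
    and antipode_right: "tensor_lift sH (\<lambda>g g'. g * S g') (\<Delta> h) = sH (\<epsilon> h) 1"


section \<open>Lie algebras\<close>

text \<open>The whole space is the internal direct sum of the subspaces \<open>A i\<close>, \<open>i \<in> J\<close> (\<open>J\<close> finite).\<close>

definition direct_sum :: "'i set \<Rightarrow> ('i \<Rightarrow> 'l::ab_group_add set) \<Rightarrow> bool"
  where "direct_sum J A \<longleftrightarrow> bij_betw (\<lambda>f. \<Sum>i\<in>J. f i) (Pi\<^sub>E J A) UNIV"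

locale lie_algebra = vector_space sL
  for sL :: "'k::field \<Rightarrow> 'l::ab_group_add \<Rightarrow> 'l" +
  fixes br :: "'l \<Rightarrow> 'l \<Rightarrow> 'l"
  assumes br_bilinear: "bilinear_map sL sL sL br"
    and br_self: "br x x = 0"
    and jacobi: "br x (br y z) + br y (br z x) + br z (br x y) = 0"
begin

definition lie_subalgebra :: "'l set \<Rightarrow> bool"
  where "lie_subalgebra A \<longleftrightarrow> subspace A \<and> (\<forall>x\<in>A. \<forall>y\<in>A. br x y \<in> A)"

text \<open>\<open>I\<close> is an ideal of the subalgebra \<open>A\<close>.\<close>

definition lie_ideal :: "'l set \<Rightarrow> 'l set \<Rightarrow> bool"
  where "lie_ideal A I \<longleftrightarrow> subspace I \<and> I \<subseteq> A \<and> (\<forall>a\<in>A. \<forall>x\<in>I. br a x \<in> I)"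

definition derived :: "'l set \<Rightarrow> 'l set"
  where "derived A = span {br x y | x y. x \<in> A \<and> y \<in> A}"

definition solvable :: "'l set \<Rightarrow> bool"
  where "solvable A \<longleftrightarrow> (\<exists>n. (derived ^^ n) A = {0})"

definition semisimple :: bool
  where "semisimple \<longleftrightarrow> (\<forall>I. lie_ideal UNIV I \<and> solvable I \<longrightarrow> I = {0})"

end


section \<open>Comodule Lie algebras\<close>

locale comodule_lie_algebra =
  H: hopf_algebra sH \<Delta> \<epsilon> S + lie_algebra sL br
  for sH :: "'k::field \<Rightarrow> 'h::ring_1 \<Rightarrow> 'h"
    and \<Delta> :: "'h \<Rightarrow> ('h, 'h, 'k) tensor"
    and \<epsilon> :: "'h \<Rightarrow> 'k"
    and S :: "'h \<Rightarrow> 'h"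
    and sL :: "'k \<Rightarrow> 'l::ab_group_add \<Rightarrow> 'l"
    and br :: "'l \<Rightarrow> 'l \<Rightarrow> 'l" +
  fixes \<rho> :: "'l \<Rightarrow> ('l, 'h, 'k) tensor"
  assumes coaction_linear: "linear_into_tensor sL sL sH \<rho>"
    and coaction_coassoc: "map_left sL sH sH \<rho> (\<rho> a) = map_right sL sH sH \<Delta> (\<rho> a)"
    and coaction_counit: "tensor_lift sL (\<lambda>b h. sL (\<epsilon> h) b) (\<rho> a) = a"
    and coaction_br: "\<rho> (br a b) = tensor_mult sL sH br (*) (\<rho> a) (\<rho> b)"
begin

definition subcomodule :: "'l set \<Rightarrow> bool"
  where "subcomodule W \<longleftrightarrow> subspace W \<and> \<rho> ` W \<subseteq> tensor_subspace sL sH W UNIV"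

text \<open>\<open>A\<close>, with the restricted structure, is an \<open>H\<close>-simple comodule Lie algebra. The zero
  subspace is not excluded.\<close>

definition H_simple :: "'l set \<Rightarrow> bool"
  where "H_simple A \<longleftrightarrow> lie_subalgebra A \<and> subcomodule A \<and>
    (\<forall>I. lie_ideal A I \<and> subcomodule I \<longrightarrow> I = {0} \<or> I = A)"

end

end

theory Submission
  imports Defs "HOL-Algebra.Algebraic_Closure_Type"
    "Jordan_Normal_Form.Jordan_Normal_Form_Existence"
begin

text \<open>
The centralizer of an ideal \<open>I\<close> that is a subcomodule is again a subcomodule: if \<open>c\<close> centralizes \<open>I\<close>
and \<open>a \<in> I\<close>, then \<open>[c\<^sub>0, a] \<otimes> c\<^sub>1 = [c\<^sub>0, a\<^sub>0] \<otimes> c\<^sub>1 a\<^sub>1 S(a\<^sub>2) = \<rho>([c, a\<^sub>0]) (1 \<otimes> S(a\<^sub>1)) = 0\<close>. In a semisimple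
Lie algebra every ideal is complemented by its centralizer, so splitting off minimal invariant
ideals one after the other gives the decomposition, and an invariant ideal of a summand is an ideal
of the whole algebra because the centralizer of the summand annihilates it.

The complement is the orthogonal space for the Killing form. It meets \<open>I\<close> trivially by Cartan's
criterion: on a perfect ideal where the Killing form vanishes, replacing each eigenvalue \<open>\<lambda>\<close> in the
semisimple part of \<open>ad x\<close> (over the algebraic closure) by \<open>\<phi>(\<lambda>)\<close>, for \<open>\<phi>\<close> \<open>\<rat>\<close>-linear with rational values,
gives \<open>\<Sum> \<lambda> \<phi>(\<lambda>) = 0\<close>, hence \<open>\<Sum> \<phi>(\<lambda>)\<^sup>2 = 0\<close>; so all \<open>ad x\<close> are nilpotent and Engel's theorem applies.
\<close>

hide_const (open) SumSpaces.direct_sum LinearCombinations.module_hom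

unbundle no fps_syntax

section \<open>Jordan form over an algebraically closed field\<close>

text \<open>The base field need not contain the eigenvalues, but the Lie algebra is never base
  changed: only the matrices of \<open>ad x\<close> move to the algebraic closure, and traces and
  nilpotency come back along \<open>to_ac\<close>. The twisted matrix \<open>D\<close> is in general
  not of the form \<open>ad y\<close>, so the vanishing of the Killing form says nothing about it
  directly. It enters through \<open>W\<close>, the trace-orthogonal space of \<open>ad P\<close>:
  \<open>W\<close> contains \<open>ad P\<close>, is stable under the bracket with
  \<open>ad x\<close>, and is stable under the bracket with \<open>D\<close> because
  \<open>ad D\<close> acts as a function of the semisimple part of \<open>ad (ad x)\<close>.
  Perfectness then finishes, since \<open>tr (ad [a, b] D) = tr ([D, ad a] ad b)\<close> and
  \<open>[D, ad a]\<close> lies in \<open>W\<close>. On the Hopf side the obstacle is that a tensor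
  is a coset with an arbitrarily chosen representative. An element of \<open>V \<otimes> H\<close>
  lies in \<open>A \<otimes> H\<close> as soon as all its images under
  \<open>id \<otimes> \<psi>\<close>, for functionals \<psi> on \<open>H\<close>, lie in
  \<open>A\<close>; so only vectors have to be compared.\<close>

lemma eigenvalue_exists:
  fixes A :: "'a::alg_closed_field mat"
  assumes A: "A \<in> carrier_mat n n" and n: "n > 0"
  shows "\<exists>a. eigenvalue A a"
proof -
  have "degree (char_poly A) = n"
    using degree_monic_char_poly[OF A] by simp
  then obtain a where "poly (char_poly A) a = 0"
    using alg_closed_imp_poly_has_root[of "char_poly A"] n by auto
  then show ?thesis
    using eigenvalue_root_char_poly[OF A] by blast
qed

lemma invertible_first_column:
  fixes v :: "'a::field vec"
  assumes v: "v \<in> carrier_vec n" "v \<noteq> 0\<^sub>v n" and n: "n > 0"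
  shows "\<exists>P Q. P \<in> carrier_mat n n \<and> Q \<in> carrier_mat n n \<and> P * Q = 1\<^sub>m n \<and> Q * P = 1\<^sub>m n
    \<and> P *\<^sub>v unit_vec n 0 = v"
proof -
  obtain j where j: "j < n" "v $ j \<noteq> 0"
    using v by (metis carrier_vecD eq_vecI index_zero_vec(1) zero_carrier_vec)
  \<comment> \<open>Apart from column 0, the columns of \<open>P\<close> are all unit vectors except
    the \<open>j\<close>-th, which \<open>v\<close> can replace because \<open>v $ j\<close> is
    nonzero. The transposition \<open>?s\<close> of 0 and \<open>j\<close> puts the unit vector of
    index 0 into column \<open>j\<close>.\<close>
  let ?s = "\<lambda>i. if i = 0 then j else if i = j then 0 else i"
  define P where "P = mat n n (\<lambda>(r, i). if i = 0 then v $ r else if r = ?s i then 1 else 0)"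
  have P: "P \<in> carrier_mat n n" by (simp add: P_def)
  have ss: "?s (?s i) = i" for i by auto
  have sn: "?s i < n" if "i < n" for i using that j n by auto
  have mv: "(P *\<^sub>v w) $ r = w $ 0 * v $ r + (if r = j then 0 else w $ (?s r))"
    if w: "w \<in> carrier_vec n" and r: "r < n" for w r
  proof -
    have "(P *\<^sub>v w) $ r = (\<Sum>i\<in>{0..<n}. P $$ (r, i) * w $ i)"
      using w r P by (simp add: scalar_prod_def row_def)
    also have "\<dots> = P $$ (r, 0) * w $ 0 + (\<Sum>i\<in>{0..<n} - {0}. P $$ (r, i) * w $ i)"
      using n by (subst sum.remove[of _ 0]) auto
    also have "(\<Sum>i\<in>{0..<n} - {0}. P $$ (r, i) * w $ i)
        = (\<Sum>i\<in>{0..<n} - {0}. if i = ?s r then w $ i else 0)"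
      by (intro sum.cong refl) (use r in \<open>auto simp: P_def\<close>)
    also have "\<dots> = (if r = j then 0 else w $ (?s r))"
      using r sn[OF r] by (auto simp: sum.delta)
    finally show ?thesis
      using r n by (simp add: P_def mult.commute)
  qed
  have "det P \<noteq> 0"
  proof
    assume "det P = 0"
    then obtain w where w: "w \<in> carrier_vec n" "w \<noteq> 0\<^sub>v n" "P *\<^sub>v w = 0\<^sub>v n"
      using det_0_iff_vec_prod_zero[OF P] by blast
    have z: "w $ 0 * v $ r + (if r = j then 0 else w $ (?s r)) = 0" if "r < n" for r
      using mv[OF w(1) that] w(3) that by simp
    have w0: "w $ 0 = 0" using z[OF j(1)] j by simp
    have "w $ i = 0" if "i < n" for i
    proof (cases "i = 0")
      case False
      then show ?thesis using z[OF sn[OF that]] w0 unfolding ss by (auto split: if_splits)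
    qed (simp add: w0)
    then show False using w(1,2) by (metis carrier_vecD eq_vecI index_zero_vec)
  qed
  then have "P \<in> Units (ring_mat TYPE('a) n ())" by (rule det_non_zero_imp_unit[OF P])
  then obtain Q where Q: "Q \<in> carrier_mat n n" "P * Q = 1\<^sub>m n" "Q * P = 1\<^sub>m n"
    unfolding Units_def ring_mat_def by auto
  have "P *\<^sub>v unit_vec n 0 = v"
    by (rule eq_vecI)
      (use v(1) n P j in \<open>auto simp: mv simp del: index_mult_mat_vec\<close>)
  then show ?thesis using P Q by blast
qed

text \<open>Deflation: a basis starting with an eigenvector makes the first column a multiple of the
  first unit vector, and the remaining block is treated by induction. The result feeds the
  conversion of triangular matrices to Jordan form.\<close>

lemma similar_upper_triangular:
  fixes A :: "'a::alg_closed_field mat"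
  assumes "A \<in> carrier_mat n n"
  shows "\<exists>B. similar_mat A B \<and> upper_triangular B"
  using assms
proof (induction n arbitrary: A)
  case 0
  then show ?case
    by (intro exI[of _ A] conjI similar_mat_refl[of _ 0]) auto
next
  case (Suc n)
  note A = Suc.prems
  obtain a where "eigenvalue A a" using eigenvalue_exists[OF A] by auto
  then obtain v where v: "v \<in> carrier_vec (Suc n)" "v \<noteq> 0\<^sub>v (Suc n)" "A *\<^sub>v v = a \<cdot>\<^sub>v v"
    using A unfolding eigenvalue_def eigenvector_def by auto
  obtain P Q where P: "P \<in> carrier_mat (Suc n) (Suc n)" and Q: "Q \<in> carrier_mat (Suc n) (Suc n)"
    and PQ: "P * Q = 1\<^sub>m (Suc n)" "Q * P = 1\<^sub>m (Suc n)" and Pv: "P *\<^sub>v unit_vec (Suc n) 0 = v"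
    using invertible_first_column[OF v(1,2)] by auto
  define B where "B = Q * A * P"
  have B: "B \<in> carrier_mat (Suc n) (Suc n)" using A P Q by (simp add: B_def)
  have "P * B * Q = (P * Q) * A * (P * Q)"
    unfolding B_def using A P Q
    by (smt (verit) assoc_mult_mat mult_carrier_mat)
  then have "A = P * B * Q" using A PQ by simp
  then have AB: "similar_mat A B"
    using A B P Q PQ by (intro similar_matI[of _ _ P Q "Suc n"]) auto
  let ?e = "unit_vec (Suc n) 0 :: 'a vec"
  have "Q *\<^sub>v v = ?e"
    using P Q PQ by (simp flip: Pv assoc_mult_mat_vec)
  then have "B *\<^sub>v ?e = a \<cdot>\<^sub>v ?e"
    using A P Q v Pv unfolding B_def
    by (simp add: assoc_mult_mat_vec[of _ "Suc n" "Suc n" _ "Suc n"] mult_mat_vec)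
  moreover have "(B *\<^sub>v ?e) $ i = B $$ (i, 0)" if "i < Suc n" for i
    using that B by simp
  ultimately have col: "B $$ (i, 0) = 0" if "i < Suc n" "i \<noteq> 0" for i
    using that by (metis index_smult_vec(1) index_unit_vec(1,3) mult_zero_right zero_less_Suc)
  obtain B1 B2 B3 B4 where sp: "split_block B 1 1 = (B1, B2, B3, B4)"
    by (metis prod_cases4)
  have bl: "B1 \<in> carrier_mat 1 1" "B2 \<in> carrier_mat 1 n" "B3 \<in> carrier_mat n 1"
    "B4 \<in> carrier_mat n n" "B = four_block_mat B1 B2 B3 B4"
    using split_block[OF sp, of n n] B by auto
  have "B3 = 0\<^sub>m n 1"
  proof (rule eq_matI)
    fix i j assume "i < dim_row (0\<^sub>m n 1)" "j < dim_col (0\<^sub>m n 1)"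
    then show "B3 $$ (i, j) = 0\<^sub>m n 1 $$ (i, j)"
      using col[of "Suc i"] bl by simp
  qed (use bl in auto)
  then have bl5: "B = four_block_mat B1 B2 (0\<^sub>m n 1) B4" using bl by simp
  obtain C where C: "similar_mat B4 C" "upper_triangular C"
    using Suc.IH[OF bl(4)] by blast
  have Cc: "C \<in> carrier_mat n n"
    using similar_matD[OF C(1)] bl(4) by auto
  obtain B0 where B0: "B0 \<in> carrier_mat 1 n"
    "similar_mat B (four_block_mat B1 B0 (0\<^sub>m n 1) C)"
    using similar_mat_four_block_0_ex[OF similar_mat_refl[OF bl(1)] C(1) bl(2,1,4)]
    unfolding bl5 by blast
  have "upper_triangular (four_block_mat B1 B0 (0\<^sub>m n 1) C)"
  proof (rule upper_triangularI)
    fix i j assume "j < i" "i < dim_row (four_block_mat B1 B0 (0\<^sub>m n 1) C)"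
    then show "four_block_mat B1 B0 (0\<^sub>m n 1) C $$ (i, j) = 0"
      using bl(1) Cc C(2) by (auto simp: upper_triangular_def)
  qed
  then show ?case using similar_mat_trans[OF AB B0(2)] by blast
qed

text \<open>A nonzero entry lies inside a single Jordan block, and there the diagonal is
  constant.\<close>

lemma jordan_matrix_diag_eq:
  "i < sum_list (map fst ns) \<Longrightarrow> j < sum_list (map fst ns) \<Longrightarrow> jordan_matrix ns $$ (i, j) \<noteq> 0
    \<Longrightarrow> jordan_matrix ns $$ (i, i) = jordan_matrix ns $$ (j, j)"
proof (induction ns arbitrary: i j)
  case (Cons na ns)
  obtain n a where na: "na = (n, a)" by force
  show ?case
    using Cons.prems Cons.IH[of "i - n" "j - n"]
    by (auto simp: na jordan_matrix_Cons split: if_splits)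
qed simp

text \<open>Of the block structure only this much is kept: the last clause says that
  \<open>J\<close> commutes with its diagonal part.\<close>

lemma jordan_form_exists:
  fixes A :: "'a::alg_closed_field mat"
  assumes A: "A \<in> carrier_mat n n"
  shows "\<exists>J. similar_mat A J \<and> J \<in> carrier_mat n n \<and> upper_triangular J \<and>
    (\<forall>i<n. \<forall>j<n. J $$ (i, j) \<noteq> 0 \<longrightarrow> J $$ (i, i) = J $$ (j, j))"
proof -
  obtain B where B: "similar_mat A B" "upper_triangular B"
    using similar_upper_triangular[OF A] by blast
  have Bc: "B \<in> carrier_mat n n" using similar_matD[OF B(1)] A by auto
  let ?ns = "triangular_to_jnf_vector B"
  have "similar_mat B (jordan_matrix ?ns)"
    using triangular_to_jnf_vector[OF Bc B(2)] by (simp add: jordan_nf_def)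
  then have s: "similar_mat A (jordan_matrix ?ns)" by (rule similar_mat_trans[OF B(1)])
  then have J: "jordan_matrix ?ns \<in> carrier_mat n n"
    using similar_matD[OF s] A by auto
  then have n: "sum_list (map fst ?ns) = n" by (metis carrier_matD(1) jordan_matrix_dim(1))
  have "upper_triangular (jordan_matrix ?ns)"
    by (rule upper_triangularI) (use jordan_matrix_upper_triangular in auto)
  then show ?thesis
    using s J jordan_matrix_diag_eq[of _ ?ns] unfolding n by blast
qed

section \<open>Commutators with a Jordan matrix\<close>

definition mat_trace :: "nat \<Rightarrow> 'a::comm_ring_1 mat \<Rightarrow> 'a"
  where "mat_trace n A = (\<Sum>i<n. A $$ (i, i))"

lemma index_mult_mat_sum:
  "A \<in> carrier_mat n n \<Longrightarrow> B \<in> carrier_mat n n \<Longrightarrow> i < n \<Longrightarrow> j < n \<Longrightarrow>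
    (A * B) $$ (i, j) = (\<Sum>k<n. A $$ (i, k) * B $$ (k, j))"
  by (simp add: scalar_prod_def atLeast0LessThan)

lemma mat_trace_comm:
  assumes "A \<in> carrier_mat n n" "B \<in> carrier_mat n n"
  shows "mat_trace n (A * B) = mat_trace n (B * A)"
proof -
  have "mat_trace n (A * B) = (\<Sum>i<n. \<Sum>k<n. A $$ (i, k) * B $$ (k, i))"
    unfolding mat_trace_def by (intro sum.cong refl index_mult_mat_sum) (use assms in auto)
  also have "\<dots> = (\<Sum>k<n. \<Sum>i<n. B $$ (k, i) * A $$ (i, k))"
    by (subst sum.swap) (simp add: mult.commute)
  also have "\<dots> = mat_trace n (B * A)"
    unfolding mat_trace_def by (intro sum.cong refl index_mult_mat_sum[symmetric]) (use assms in auto)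
  finally show ?thesis .
qed

lemma mat_trace_linear:
  assumes "A \<in> carrier_mat n n" "B \<in> carrier_mat n n"
  shows "mat_trace n (A + B) = mat_trace n A + mat_trace n B"
    "mat_trace n (A - B) = mat_trace n A - mat_trace n B"
    "mat_trace n (c \<cdot>\<^sub>m A) = c * mat_trace n A"
  using assms by (simp_all add: mat_trace_def sum.distrib sum_subtractf sum_distrib_left)

text \<open>Closure is spelled out for one fixed size because the matrix type mixes all sizes and so
  is not itself a vector space.\<close>

definition mat_subspace :: "nat \<Rightarrow> 'a::field mat set \<Rightarrow> bool"
  where "mat_subspace n W \<longleftrightarrow> W \<subseteq> carrier_mat n n \<and> 0\<^sub>m n n \<in> W \<and>
    (\<forall>A\<in>W. \<forall>B\<in>W. A + B \<in> W) \<and> (\<forall>c. \<forall>A\<in>W. c \<cdot>\<^sub>m A \<in> W)"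

lemma mat_subspaceD:
  assumes "mat_subspace n W"
  shows "A \<in> W \<Longrightarrow> A \<in> carrier_mat n n" "0\<^sub>m n n \<in> W"
    "A \<in> W \<Longrightarrow> B \<in> W \<Longrightarrow> A + B \<in> W" "A \<in> W \<Longrightarrow> c \<cdot>\<^sub>m A \<in> W"
  using assms by (auto simp: mat_subspace_def)

lemma mat_subspace_diff:
  fixes A B :: "'a::field mat"
  assumes W: "mat_subspace n W" and "A \<in> W" "B \<in> W"
  shows "A - B \<in> W"
proof -
  have "A - B = A + (-1) \<cdot>\<^sub>m B"
    by (rule eq_matI) (use assms mat_subspaceD(1)[OF W] in auto)
  then show ?thesis using mat_subspaceD(3)[OF W assms(2) mat_subspaceD(4)[OF W assms(3)]] by simp
qed

text \<open>The aim is \<open>weighted_mem\<close>: \<open>W\<close> is stable under every function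
  of the semisimple part of \<open>ad J\<close>. That part multiplies entry \<open>(i, j)\<close> by
  the difference of the diagonal entries of \<open>J\<close> at \<open>i\<close> and
  \<open>j\<close>, so its eigenspaces are given by supports and the stability can be proved on
  entries, without polynomials in \<open>ad J\<close>.\<close>

locale jordan_commutator =
  fixes n :: nat and J :: "'a::field mat" and W :: "'a mat set"
  assumes J: "J \<in> carrier_mat n n" and ut: "upper_triangular J"
    and diag: "\<And>i j. i < n \<Longrightarrow> j < n \<Longrightarrow> J $$ (i, j) \<noteq> 0 \<Longrightarrow> J $$ (i, i) = J $$ (j, j)"
    and W: "mat_subspace n W"
    and inv: "\<And>A. A \<in> W \<Longrightarrow> J * A - A * J \<in> W"
begin

abbreviation ev where "ev i \<equiv> J $$ (i, i)"

text \<open>This is \<open>ad J - p\<close>, nilpotent on the generalized eigenspace for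
  \<open>p\<close> and bijective on the others.\<close>

definition shifted :: "'a \<Rightarrow> 'a mat \<Rightarrow> 'a mat"
  where "shifted p A = (J * A - A * J) - p \<cdot>\<^sub>m A"

text \<open>Membership in the sum of the generalized eigenspaces of \<open>ad J\<close> for the
  eigenvalues in \<open>M\<close>.\<close>

definition supp :: "'a set \<Rightarrow> 'a mat \<Rightarrow> bool"
  where "supp M A \<longleftrightarrow> A \<in> carrier_mat n n \<and>
    (\<forall>i<n. \<forall>j<n. A $$ (i, j) \<noteq> 0 \<longrightarrow> ev i - ev j \<in> M)"

text \<open>Filtration by superdiagonals. It runs from \<open>- int n\<close>, where every matrix
  qualifies, to \<open>int n\<close>, where only zero is left; hence the integer index.\<close>

definition deep :: "int \<Rightarrow> 'a mat \<Rightarrow> bool"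
  where "deep d A \<longleftrightarrow> (\<forall>i<n. \<forall>j<n. int j - int i < d \<longrightarrow> A $$ (i, j) = 0)"

text \<open>The function \<phi> applied to the semisimple part of \<open>ad J\<close>; an indicator
  function gives a projection to generalized eigenspaces.\<close>

definition weighted :: "('a \<Rightarrow> 'a) \<Rightarrow> 'a mat \<Rightarrow> 'a mat"
  where "weighted \<phi> A = mat n n (\<lambda>(i, j). \<phi> (ev i - ev j) * A $$ (i, j))"

lemma shifted_carrier [simp]: "A \<in> carrier_mat n n \<Longrightarrow> shifted p A \<in> carrier_mat n n"
  using J by (simp add: shifted_def minus_carrier_mat)

lemma weighted_carrier [simp]: "weighted \<phi> A \<in> carrier_mat n n"
  by (simp add: weighted_def)

lemma shifted_index:
  "A \<in> carrier_mat n n \<Longrightarrow> i < n \<Longrightarrow> j < n \<Longrightarrow> shifted p A $$ (i, j) =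
    (\<Sum>k<n. J $$ (i, k) * A $$ (k, j)) - (\<Sum>k<n. A $$ (i, k) * J $$ (k, j)) - p * A $$ (i, j)"
  using J by (simp add: shifted_def index_mult_mat_sum[of _ n] del: index_mult_mat(1))

lemma shifted_mem: "A \<in> W \<Longrightarrow> shifted p A \<in> W"
  unfolding shifted_def by (intro mat_subspace_diff[OF W] mat_subspaceD(4)[OF W] inv)

text \<open>\<open>J\<close> links only indices with equal diagonal entries, so the weight is the
  same in all nonzero summands of the matrix products and can be pulled out.\<close>

lemma shifted_weighted:
  assumes A: "A \<in> carrier_mat n n"
  shows "shifted p (weighted \<phi> A) = weighted \<phi> (shifted p A)"
proof (rule eq_matI)
  fix i j assume "i < dim_row (weighted \<phi> (shifted p A))" "j < dim_col (weighted \<phi> (shifted p A))"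
  then have ij: "i < n" "j < n" by (simp_all add: weighted_def)
  have 1: "J $$ (i, k) * (\<phi> (ev k - ev j) * A $$ (k, j)) = \<phi> (ev i - ev j) * (J $$ (i, k) * A $$ (k, j))"
    if "k < n" for k
    using diag[OF ij(1) that] by (cases "J $$ (i, k) = 0") auto
  have 2: "\<phi> (ev i - ev k) * A $$ (i, k) * J $$ (k, j) = \<phi> (ev i - ev j) * (A $$ (i, k) * J $$ (k, j))"
    if "k < n" for k
    using diag[OF that ij(2)] by (cases "J $$ (k, j) = 0") auto
  show "shifted p (weighted \<phi> A) $$ (i, j) = weighted \<phi> (shifted p A) $$ (i, j)"
    using ij A
    by (simp add: shifted_index weighted_def 1 2 right_diff_distrib flip: sum_distrib_left)
qed (use A in \<open>simp_all add: shifted_def weighted_def\<close>)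

text \<open>\<open>supp M\<close> amounts to being fixed by the weight of the indicator function of
  \<open>M\<close>, and weights commute with \<open>shifted\<close>.\<close>

lemma supp_shifted:
  assumes "supp M A" shows "supp M (shifted p A)"
proof -
  have A: "A \<in> carrier_mat n n" using assms by (simp add: supp_def)
  have "weighted (\<lambda>x. if x \<in> M then 1 else 0) A = A"
    by (rule eq_matI) (use assms in \<open>force simp: supp_def weighted_def\<close>)+
  then have "shifted p A = weighted (\<lambda>x. if x \<in> M then 1 else 0) (shifted p A)"
    using shifted_weighted[OF A, of p "\<lambda>x. if x \<in> M then 1 else 0"] by simp
  then have eq: "weighted (\<lambda>x. if x \<in> M then 1 else 0) (shifted p A) = shifted p A" by simp
  have "ev i - ev j \<in> M" if "i < n" "j < n" "shifted p A $$ (i, j) \<noteq> 0" for i j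
  proof (rule ccontr)
    assume "ev i - ev j \<notin> M"
    then have "weighted (\<lambda>x. if x \<in> M then 1 else 0) (shifted p A) $$ (i, j) = 0"
      using that(1,2) by (simp add: weighted_def)
    then show False unfolding eq using that(3) by simp
  qed
  then show ?thesis using A by (auto simp: supp_def)
qed

text \<open>On the support of \<open>A\<close> the diagonal of \<open>J\<close> contributes
  \<open>ev i - ev j - p = 0\<close>. What is left comes from the strictly upper part of
  \<open>J\<close>, which raises \<open>j - i\<close>.\<close>

lemma deep_shifted:
  assumes A: "supp {p} A" "deep d A"
  shows "deep (d + 1) (shifted p A)"
  unfolding deep_def
proof (intro allI impI)
  fix i j assume ij: "i < n" "j < n" "int j - int i < d + 1"
  have Ac: "A \<in> carrier_mat n n" using A by (simp add: supp_def)
  have "J $$ (i, k) * A $$ (k, j) = 0" if "k < n" "k \<noteq> i" for k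
  proof (cases "k < i")
    case True
    then show ?thesis using upper_triangularD[OF ut True] ij J by simp
  next
    case False
    then show ?thesis using A(2) that ij by (simp add: deep_def)
  qed
  then have "(\<Sum>k<n. J $$ (i, k) * A $$ (k, j)) = (\<Sum>k<n. if k = i then ev i * A $$ (i, j) else 0)"
    by (intro sum.cong) auto
  moreover have "A $$ (i, k) * J $$ (k, j) = 0" if "k < n" "k \<noteq> j" for k
  proof (cases "j < k")
    case True
    then show ?thesis using upper_triangularD[OF ut True] that J by simp
  next
    case False
    then show ?thesis using A(2) that ij by (simp add: deep_def)
  qed
  then have "(\<Sum>k<n. A $$ (i, k) * J $$ (k, j)) = (\<Sum>k<n. if k = j then A $$ (i, j) * ev j else 0)"
    by (intro sum.cong) auto
  ultimately have "shifted p A $$ (i, j) = (ev i - ev j - p) * A $$ (i, j)"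
    using ij by (simp add: shifted_index[OF Ac] algebra_simps)
  then show "shifted p A $$ (i, j) = 0"
    using A(1) ij by (cases "A $$ (i, j) = 0") (auto simp: supp_def)
qed

lemma deep_n: "A \<in> carrier_mat n n \<Longrightarrow> deep (int n) A \<Longrightarrow> A = 0\<^sub>m n n"
  by (rule eq_matI) (auto simp: deep_def)

lemma deep_start: "deep (- int n) A"
  by (auto simp: deep_def)

lemma deep_induct [consumes 1, case_names zero step]:
  assumes "d \<le> int n" "P (int n)" "\<And>d. d < int n \<Longrightarrow> P (d + 1) \<Longrightarrow> P d"
  shows "P d"
  using assms(1)
proof (induction "nat (int n - d)" arbitrary: d)
  case 0
  then show ?case using assms(2) by simp
next
  case (Suc m)
  then show ?case using assms(3)[of d] by auto
qed

lemma shifted_shifted: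
  assumes A: "A \<in> carrier_mat n n"
  shows "shifted a (shifted b A) = (J * (J * A - A * J) - (J * A - A * J) * J) -
    (a + b) \<cdot>\<^sub>m (J * A - A * J) + (a * b) \<cdot>\<^sub>m A"
proof -
  let ?T = "J * A - A * J"
  have T: "?T \<in> carrier_mat n n" using J A by (simp add: minus_carrier_mat)
  have cT: "b \<cdot>\<^sub>m A \<in> carrier_mat n n" using A by simp
  have 1: "J * shifted b A = J * ?T - b \<cdot>\<^sub>m (J * A)"
    unfolding shifted_def mult_minus_distrib_mat[OF J T cT] mult_smult_distrib[OF J A] ..
  have 2: "shifted b A * J = ?T * J - b \<cdot>\<^sub>m (A * J)"
    unfolding shifted_def minus_mult_distrib_mat[OF T cT J] mult_smult_assoc_mat[OF A J] ..
  show ?thesis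
    unfolding shifted_def[of a] 1 2
    by (rule eq_matI)
      (use J A T in \<open>simp_all add: shifted_def algebra_simps del: index_mult_mat(1)\<close>)
qed

lemma shifted_commute:
  "A \<in> carrier_mat n n \<Longrightarrow> shifted a (shifted b A) = shifted b (shifted a A)"
  by (simp add: shifted_shifted add.commute mult.commute)

text \<open>\<open>ad J - q\<close> is invertible on the eigenspace for \<open>p\<close>:
  \<open>(p - q) A\<close> is the difference of \<open>shifted q A\<close> and
  \<open>shifted p A\<close>, and the latter is one level deeper, so downward induction on the depth
  applies.\<close>

lemma mem_if_shifted_mem:
  assumes "q \<noteq> p" "d \<le> int n" "supp {p} A" "deep d A" "shifted q A \<in> W"
  shows "A \<in> W"
  using assms(2-)
proof (induction arbitrary: A rule: deep_induct)
  case zero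
  then have "A = 0\<^sub>m n n" by (intro deep_n) (auto simp: supp_def)
  then show ?case using mat_subspaceD[OF W] by simp
next
  case (step d)
  have A: "A \<in> carrier_mat n n" using step by (simp add: supp_def)
  have "shifted q (shifted p A) = shifted p (shifted q A)" by (rule shifted_commute[OF A])
  then have "shifted q (shifted p A) \<in> W"
    using shifted_mem[OF step.prems(3), of p] by simp
  then have "shifted p A \<in> W"
    by (rule step.IH[OF supp_shifted[OF step.prems(1)] deep_shifted[OF step.prems(1,2)]])
  then have m: "(1 / (p - q)) \<cdot>\<^sub>m (shifted q A - shifted p A) \<in> W"
    by (intro mat_subspace_diff[OF W] mat_subspaceD(4)[OF W] step.prems)
  have "shifted q A - shifted p A = (p - q) \<cdot>\<^sub>m A"
    by (rule eq_matI) (use A J in \<open>auto simp: shifted_def algebra_simps simp del: index_mult_mat(1)\<close>)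
  then have "(1 / (p - q)) \<cdot>\<^sub>m (shifted q A - shifted p A) = A"
    by (intro eq_matI) (use A \<open>q \<noteq> p\<close> in auto)
  then show ?case using m by simp
qed

abbreviation component :: "'a \<Rightarrow> 'a mat \<Rightarrow> 'a mat"
  where "component p \<equiv> weighted (\<lambda>x. if x = p then 1 else 0)"

lemma supp_component: "supp {p} (component p A)"
  by (auto simp: supp_def weighted_def)

lemma weighted_from_components:
  assumes "finite M" "supp M A" "\<And>p. p \<in> M \<Longrightarrow> component p A \<in> W"
  shows "weighted \<phi> A \<in> W"
proof -
  have "weighted (\<lambda>x. if x \<in> F then \<phi> x else 0) A \<in> W" if "F \<subseteq> M" for F
    using finite_subset[OF that \<open>finite M\<close>] that
  proof (induction F rule: finite_induct)
    case empty
    have "weighted (\<lambda>x. if x \<in> {} then \<phi> x else 0) A = 0\<^sub>m n n"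
      by (rule eq_matI) (auto simp: weighted_def)
    then show ?case using mat_subspaceD[OF W] by simp
  next
    case (insert p F)
    have "weighted (\<lambda>x. if x \<in> insert p F then \<phi> x else 0) A =
        \<phi> p \<cdot>\<^sub>m component p A + weighted (\<lambda>x. if x \<in> F then \<phi> x else 0) A"
      by (rule eq_matI) (use insert in \<open>auto simp: weighted_def\<close>)
    then show ?case using insert assms(3) mat_subspaceD[OF W] by auto
  qed
  from this[of M] have "weighted (\<lambda>x. if x \<in> M then \<phi> x else 0) A \<in> W" by simp
  moreover have "weighted (\<lambda>x. if x \<in> M then \<phi> x else 0) A = weighted \<phi> A"
    by (rule eq_matI) (use assms(2) in \<open>auto simp: weighted_def supp_def\<close>)
  ultimately show ?thesis by simp
qed

lemma weighted_one: "supp M A \<Longrightarrow> weighted (\<lambda>_. 1) A = A"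
  by (rule eq_matI) (auto simp: weighted_def supp_def)

text \<open>Repeated application of \<open>ad J - q\<close> destroys the part of \<open>A\<close> at
  one eigenvalue \<open>q\<close>, the induction hypothesis splits the rest, and invertibility of
  \<open>ad J - q\<close> on the other components undoes the application.\<close>

lemma component_mem:
  assumes "finite M" "supp M A" "A \<in> W"
  shows "component p A \<in> W"
  using assms
proof (induction M arbitrary: A p rule: finite_induct)
  case empty
  then have "component p A = 0\<^sub>m n n"
    by (intro eq_matI) (auto simp: weighted_def supp_def)
  then show ?case using mat_subspaceD[OF W] by simp
next
  case (insert q M)
  \<comment> \<open>Only the sum \<open>C + B\<close> is known to lie in \<open>W\<close>. The
    induction is on the depth of \<open>C\<close>, the part at \<open>q\<close>, while
    \<open>B\<close> changes along.\<close>
  have *: "\<forall>p. component p B \<in> W"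
    if "d \<le> int n" "supp {q} C" "deep d C" "supp M B" "C + B \<in> W" for d B C
    using that
  proof (induction arbitrary: B C rule: deep_induct)
    case zero
    then have "C = 0\<^sub>m n n" by (intro deep_n) (auto simp: supp_def)
    then have "B \<in> W" using zero by (simp add: supp_def)
    then show ?case using insert.IH zero by blast
  next
    case (step d)
    have BC: "B \<in> carrier_mat n n" "C \<in> carrier_mat n n" using step by (auto simp: supp_def)
    have "shifted q (C + B) = shifted q C + shifted q B"
    proof (rule eq_matI)
      fix i j assume "i < dim_row (shifted q C + shifted q B)" "j < dim_col (shifted q C + shifted q B)"
      then have "i < n" "j < n" using shifted_carrier[OF BC(1), of q] by auto
      then show "shifted q (C + B) $$ (i, j) = (shifted q C + shifted q B) $$ (i, j)"
        using BC carrier_matD[OF shifted_carrier[OF BC(1), of q]]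
        by (simp add: shifted_index sum.distrib algebra_simps)
    qed (use BC carrier_matD[OF shifted_carrier[of "C + B" q]]
        carrier_matD[OF shifted_carrier[OF BC(1), of q]] in auto)
    then have sh: "\<forall>p. component p (shifted q B) \<in> W"
      using shifted_mem[OF step.prems(4), of q]
      by (intro step.IH[OF supp_shifted[OF step.prems(1)] deep_shifted[OF step.prems(1,2)]
            supp_shifted[OF step.prems(3)]]) simp
    show ?case
    proof
      fix p
      show "component p B \<in> W"
      proof (cases "p = q")
        case True
        then have "component p B = 0\<^sub>m n n"
          using step.prems(3) insert.hyps by (intro eq_matI) (auto simp: weighted_def supp_def)
        then show ?thesis using mat_subspaceD[OF W] by simp
      next
        case False
        have "shifted q (component p B) \<in> W"
          using sh shifted_weighted[OF BC(1)] by metis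
        then show ?thesis
          by (intro mem_if_shifted_mem[OF _ _ supp_component deep_start, of q]) (use False in auto)
      qed
    qed
  qed
  have A: "A \<in> carrier_mat n n" using insert.prems by (simp add: supp_def)
  let ?C = "component q A" and ?B = "weighted (\<lambda>x. if x = q then 0 else 1) A"
  have AB: "?C + ?B = A" by (rule eq_matI) (use A in \<open>auto simp: weighted_def\<close>)
  have sB: "supp M ?B" using insert.prems by (auto simp: supp_def weighted_def)
  have cB: "component p ?B \<in> W" for p
    using *[OF _ supp_component deep_start sB, of A] insert.prems AB by auto
  show ?case
  proof (cases "p = q")
    case True
    \<comment> \<open>The component at \<open>q\<close> is what remains of \<open>A\<close> after
      subtracting all the others.\<close>
    have "?B \<in> W"
      using weighted_from_components[OF insert.hyps(1) sB cB, of "\<lambda>_. 1"] weighted_one[OF sB] by simp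
    then have "A - ?B \<in> W" using mat_subspace_diff[OF W insert.prems(2)] by blast
    moreover have "A - ?B = ?C" by (rule eq_matI) (use A in \<open>auto simp: weighted_def\<close>)
    ultimately show ?thesis using True by simp
  next
    case False
    then have "component p ?B = component p A"
      by (intro eq_matI) (auto simp: weighted_def)
    then show ?thesis using cB[of p] by simp
  qed
qed

lemma weighted_mem:
  assumes "A \<in> W" shows "weighted \<phi> A \<in> W"
proof -
  let ?M = "(\<lambda>(i, j). ev i - ev j) ` ({..<n} \<times> {..<n})"
  have M: "finite ?M" "supp ?M A"
    using assms mat_subspaceD(1)[OF W] by (auto simp: supp_def)
  show ?thesis
    by (rule weighted_from_components[OF M component_mem[OF M assms]])
qed

end

section \<open>Transport to and from Jordan coordinates, and Cartan's eigenvalue argument\<close>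

lemma conj_mult_mat:
  fixes A :: "'a::comm_ring_1 mat"
  assumes A: "A \<in> carrier_mat n n" "B \<in> carrier_mat n n" "P \<in> carrier_mat n n" "Q \<in> carrier_mat n n"
    and QP: "Q * P = 1\<^sub>m n"
  shows "P * (A * B) * Q = (P * A * Q) * (P * B * Q)"
proof -
  have "(P * A * Q) * (P * B * Q) = P * A * ((Q * P) * (B * Q))"
    using A by (simp add: assoc_mult_mat[of _ n n _ n _ n])
  also have "\<dots> = P * (A * B) * Q"
    unfolding QP using A by (simp add: assoc_mult_mat[of _ n n _ n _ n])
  finally show ?thesis by simp
qed

lemma conj_cancel_mat:
  fixes A :: "'a::comm_ring_1 mat"
  assumes A: "A \<in> carrier_mat n n" "P \<in> carrier_mat n n" "Q \<in> carrier_mat n n"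
    and PQ: "P * Q = 1\<^sub>m n"
  shows "P * (Q * A * P) * Q = A"
proof -
  have "P * (Q * A * P) * Q = (P * Q) * (A * (P * Q))"
    using A by (simp add: assoc_mult_mat[of _ n n _ n _ n])
  then show ?thesis using A by (simp add: PQ)
qed

lemma conj_linear_mat:
  fixes A :: "'a::comm_ring_1 mat"
  assumes "A \<in> carrier_mat n n" "B \<in> carrier_mat n n" "P \<in> carrier_mat n n" "Q \<in> carrier_mat n n"
  shows "P * (A + B) * Q = P * A * Q + P * B * Q"
    "P * (A - B) * Q = P * A * Q - P * B * Q"
    "P * (c \<cdot>\<^sub>m A) * Q = c \<cdot>\<^sub>m (P * A * Q)"
  using assms
  by (simp_all add: mult_add_distrib_mat[of _ n n _ n] add_mult_distrib_mat[of _ n n _ _ n]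
      mult_minus_distrib_mat[of _ n n _ n] minus_mult_distrib_mat[of _ n n _ _ n]
      mult_smult_distrib[of _ n n _ n] mult_smult_assoc_mat[of _ n n _ n])

lemma strictly_upper_triangular_pow:
  fixes J :: "'a::comm_ring_1 mat"
  assumes J: "J \<in> carrier_mat n n" and su: "\<And>i j. i < n \<Longrightarrow> j \<le> i \<Longrightarrow> J $$ (i, j) = 0"
  shows "J ^\<^sub>m n = 0\<^sub>m n n"
proof -
  have "(J ^\<^sub>m k) $$ (i, j) = 0" if "i < n" "j < n" "j < i + k" for i j k
    using that
  proof (induction k arbitrary: i j)
    case (Suc k)
    have "(J ^\<^sub>m k) $$ (i, l) * J $$ (l, j) = 0" if "l < n" for l
      using Suc.IH[of i l] su[of l j] that Suc.prems by (cases "l < i + k") auto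
    then show ?case
      using Suc.prems J by (simp add: index_mult_mat_sum[of _ n] del: index_mult_mat(1))
  qed (use J in simp)
  then show ?thesis using J by (intro eq_matI) auto
qed

text \<open>\<open>D\<close> is the semisimple part of \<open>T\<close> with each eigenvalue \<open>\<lambda>\<close> replaced by \<open>\<phi> \<lambda>\<close>; additivity of
  \<open>\<phi>\<close> makes \<open>ad D\<close> act on the generalized eigenspace of \<open>ad T\<close> for \<open>\<lambda> - \<mu>\<close> as \<open>\<phi> (\<lambda> - \<mu>)\<close>.\<close>

lemma twisted_semisimple_part:
  fixes T :: "'a::alg_closed_field mat"
  assumes T: "T \<in> carrier_mat n n" and W: "mat_subspace n W"
    and inv: "\<And>A. A \<in> W \<Longrightarrow> T * A - A * T \<in> W"
  shows "\<exists>ev. ((\<forall>i<n. ev i = 0) \<longrightarrow> T ^\<^sub>m n = 0\<^sub>m n n) \<and>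
    (\<forall>\<phi>. (\<forall>x y. \<phi> (x - y) = \<phi> x - \<phi> y) \<longrightarrow>
      (\<exists>D\<in>carrier_mat n n. (\<forall>A\<in>W. D * A - A * D \<in> W) \<and>
        mat_trace n (T * D) = (\<Sum>i<n. ev i * \<phi> (ev i))))"
proof -
  obtain J where sim: "similar_mat T J" and J: "J \<in> carrier_mat n n" and ut: "upper_triangular J"
    and diag: "\<forall>i<n. \<forall>j<n. J $$ (i, j) \<noteq> 0 \<longrightarrow> J $$ (i, i) = J $$ (j, j)"
    using jordan_form_exists[OF T] by metis
  obtain P Q where wit: "similar_mat_wit T J P Q"
    using sim by (auto simp: similar_mat_def)
  note PQ = similar_mat_witD2(6,7,1,2)[OF T wit] and TJ = similar_mat_witD2(3)[OF T wit]
  have JT: "J = Q * T * P"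
    unfolding TJ using conj_cancel_mat[OF J PQ(2,1,4)] by simp
  \<comment> \<open>The eigenvalues \<open>ev\<close> are fixed before \<phi>, since \<phi> is later
    chosen for one particular nonzero eigenvalue.\<close>
  show ?thesis
  proof (intro exI[of _ "\<lambda>i. J $$ (i, i)"] conjI impI allI)
    assume 0: "\<forall>i<n. J $$ (i, i) = 0"
    have "J ^\<^sub>m n = 0\<^sub>m n n"
    proof (rule strictly_upper_triangular_pow[OF J])
      fix i j assume "i < n" "j \<le> i"
      then show "J $$ (i, j) = 0"
        using 0 upper_triangularD[OF ut, of j i] J by (cases "j = i") auto
    qed
    then show "T ^\<^sub>m n = 0\<^sub>m n n"
      using similar_mat_wit_pow_id[OF wit, of n] PQ by simp
  next
    fix \<phi> :: "'a \<Rightarrow> 'a"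
    assume \<phi>: "\<forall>x y. \<phi> (x - y) = \<phi> x - \<phi> y"
    note Wc = mat_subspaceD(1)[OF W]
    define W' where "W' = (\<lambda>A. Q * A * P) ` W"
    have W': "mat_subspace n W'"
      unfolding mat_subspace_def
    proof (intro conjI ballI allI)
      show "W' \<subseteq> carrier_mat n n" using PQ Wc by (auto simp: W'_def)
      show "0\<^sub>m n n \<in> W'"
        unfolding W'_def using mat_subspaceD(2)[OF W] PQ by (intro image_eqI[of _ _ "0\<^sub>m n n"]) auto
    next
      fix A B assume "A \<in> W'" "B \<in> W'"
      then obtain a b where "A = Q * a * P" "B = Q * b * P" "a \<in> W" "b \<in> W" by (auto simp: W'_def)
      then show "A + B \<in> W'"
        unfolding W'_def using conj_linear_mat(1)[of a n b Q P] Wc PQ mat_subspaceD(3)[OF W]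
        by (intro image_eqI[of _ _ "a + b"]) auto
    next
      fix A c assume "A \<in> W'"
      then obtain a where "A = Q * a * P" "a \<in> W" by (auto simp: W'_def)
      then show "c \<cdot>\<^sub>m A \<in> W'"
        unfolding W'_def using conj_linear_mat(3)[of a n _ Q P] Wc PQ mat_subspaceD(4)[OF W]
        by (intro image_eqI[of _ _ "c \<cdot>\<^sub>m a"]) auto
    qed
    have comm: "Q * (Y * A - A * Y) * P = (Q * Y * P) * (Q * A * P) - (Q * A * P) * (Q * Y * P)"
      if "A \<in> carrier_mat n n" "Y \<in> carrier_mat n n" for A Y
      using that PQ conj_mult_mat[OF that(1,2) PQ(2,1,3)] conj_mult_mat[OF that(2,1) PQ(2,1,3)]
        conj_linear_mat(2)[of "Y * A" n "A * Y" Q P] by simp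
    interpret jordan_commutator n J W'
    proof
      fix A assume "A \<in> W'"
      then obtain a where a: "A = Q * a * P" "a \<in> W" by (auto simp: W'_def)
      have "J * A - A * J = Q * (T * a - a * T) * P"
        using comm[OF Wc[OF a(2)] T] a(1) JT by simp
      then show "J * A - A * J \<in> W'" using inv a(2) by (auto simp: W'_def)
    qed (use J ut diag W' in auto)
    \<comment> \<open>In Jordan coordinates the twisted semisimple part is diagonal. Additivity of
      \<phi> turns \<open>\<phi> (ev i) - \<phi> (ev j)\<close>, the factor produced by the
      commutator, into the weight \<open>\<phi> (ev i - ev j)\<close>.\<close>
    define E where "E = mat n n (\<lambda>(i, j). if i = j then \<phi> (ev i) else 0)"
    have E: "E \<in> carrier_mat n n" by (simp add: E_def)
    have EA: "E * A - A * E = weighted \<phi> A" if A: "A \<in> carrier_mat n n" for A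
    proof (rule eq_matI)
      fix i j assume "i < dim_row (weighted \<phi> A)" "j < dim_col (weighted \<phi> A)"
      then have ij: "i < n" "j < n" by (auto simp: weighted_def)
      have 1: "(E * A) $$ (i, j) = (\<Sum>k<n. if k = i then \<phi> (ev i) * A $$ (i, j) else 0)"
        unfolding index_mult_mat_sum[OF E A ij] by (intro sum.cong) (use ij in \<open>auto simp: E_def\<close>)
      have 2: "(A * E) $$ (i, j) = (\<Sum>k<n. if k = j then A $$ (i, j) * \<phi> (ev j) else 0)"
        unfolding index_mult_mat_sum[OF A E ij] by (intro sum.cong) (use ij in \<open>auto simp: E_def\<close>)
      have "(E * A - A * E) $$ (i, j) = (E * A) $$ (i, j) - (A * E) $$ (i, j)"
        using A E ij by simp
      then show "(E * A - A * E) $$ (i, j) = weighted \<phi> A $$ (i, j)"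
        unfolding 1 2 using ij by (simp add: weighted_def \<phi>[rule_format] left_diff_distrib right_diff_distrib mult.commute)
    qed (use A E in \<open>auto simp: weighted_def\<close>)
    define D where "D = P * E * Q"
    have D: "D \<in> carrier_mat n n" using PQ E by (simp add: D_def)
    have QDP: "Q * D * P = E"
      unfolding D_def using conj_cancel_mat[OF E PQ(2,1,4)] .
    show "\<exists>D\<in>carrier_mat n n. (\<forall>A\<in>W. D * A - A * D \<in> W) \<and>
        mat_trace n (T * D) = (\<Sum>i<n. ev i * \<phi> (ev i))"
    proof (intro bexI[OF _ D] conjI ballI)
      fix A assume A: "A \<in> W"
      have DA: "D * A - A * D \<in> carrier_mat n n"
        using D Wc[OF A] by (simp add: minus_carrier_mat)
      have "Q * (D * A - A * D) * P = weighted \<phi> (Q * A * P)"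
        using comm[OF Wc[OF A] D] EA[of "Q * A * P"] PQ Wc[OF A] by (simp add: QDP)
      also have "\<dots> \<in> W'" using A by (intro weighted_mem) (auto simp: W'_def)
      finally obtain a where a: "Q * (D * A - A * D) * P = Q * a * P" "a \<in> W" by (auto simp: W'_def)
      have "D * A - A * D = P * (Q * (D * A - A * D) * P) * Q"
        by (rule conj_cancel_mat[OF DA PQ(1-3), symmetric])
      also have "\<dots> = a"
        unfolding a(1) by (rule conj_cancel_mat[OF Wc[OF a(2)] PQ(1-3)])
      finally have "D * A - A * D = a" .
      then show "D * A - A * D \<in> W" using a(2) by simp
    next
      \<comment> \<open>\<open>E\<close> is diagonal, so the off-diagonal entries of
        \<open>J\<close> do not reach the trace.\<close>
      have "(J * E) $$ (i, i) = ev i * \<phi> (ev i)" if "i < n" for i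
      proof -
        have "(J * E) $$ (i, i) = (\<Sum>k<n. if k = i then ev i * \<phi> (ev i) else 0)"
          unfolding index_mult_mat_sum[OF J E that that]
          by (intro sum.cong) (use that in \<open>auto simp: E_def\<close>)
        then show ?thesis using that by simp
      qed
      then have tr: "mat_trace n (J * E) = (\<Sum>i<n. ev i * \<phi> (ev i))"
        by (simp add: mat_trace_def del: index_mult_mat)
      have "T * D = (P * (J * E)) * Q"
        unfolding D_def TJ by (rule conj_mult_mat[OF J E PQ(1,2,4), symmetric])
      then have "mat_trace n (T * D) = mat_trace n (Q * (P * (J * E)))"
        using mat_trace_comm[of "P * (J * E)" n Q] PQ J E by simp
      also have "Q * (P * (J * E)) = (Q * P) * (J * E)"
        by (rule assoc_mult_mat[symmetric]) (use PQ J E in auto)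
      also have "\<dots> = J * E"
        unfolding PQ(4) using J E by (intro left_mult_one_mat) auto
      finally show "mat_trace n (T * D) = (\<Sum>i<n. ev i * \<phi> (ev i))" unfolding tr .
    qed
  qed
qed

text \<open>Over the rationals a nonzero \<open>a\<close> is linearly independent, so the functional
  sending it to 1 extends to the whole field.\<close>

lemma rational_functional_exists:
  fixes a :: "'a::field_char_0"
  assumes "a \<noteq> 0"
  shows "\<exists>\<phi>::'a \<Rightarrow> rat. (\<forall>x y. \<phi> (x - y) = \<phi> x - \<phi> y) \<and> (\<forall>q x. \<phi> (of_rat q * x) = q * \<phi> x) \<and> \<phi> a = 1"
proof -
  interpret vector_space_pair "\<lambda>(q::rat) (x::'a). of_rat q * x" "(*) :: rat \<Rightarrow> rat \<Rightarrow> rat"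
    by unfold_locales (simp_all add: algebra_simps of_rat_add of_rat_mult)
  have "vs1.independent {a}" using assms by (simp add: vs1.independent_insert)
  from linear_independent_extend[OF this, of "\<lambda>_. 1"]
  obtain g where g: "Vector_Spaces.linear (\<lambda>q x. of_rat q * x) (*) g" "g a = 1" by auto
  interpret g: Vector_Spaces.linear "\<lambda>(q::rat) (x::'a). of_rat q * x" "(*) :: rat \<Rightarrow> rat \<Rightarrow> rat" g
    by (rule g(1))
  show ?thesis using g.diff g.scale g(2) by blast
qed

text \<open>Cartan's lemma for a single matrix: \<open>tr\<close> is orthogonality to everything
  that normalizes \<open>W\<close>, and testing it on the twisted parts \<open>D\<close> excludes
  each nonzero eigenvalue.\<close>

lemma nilpotent_if_trace_condition:
  fixes T :: "'a::{alg_closed_field, field_char_0} mat"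
  assumes T: "T \<in> carrier_mat n n" and W: "mat_subspace n W"
    and inv: "\<And>A. A \<in> W \<Longrightarrow> T * A - A * T \<in> W"
    and tr: "\<And>D. D \<in> carrier_mat n n \<Longrightarrow> (\<And>A. A \<in> W \<Longrightarrow> D * A - A * D \<in> W) \<Longrightarrow> mat_trace n (T * D) = 0"
  shows "T ^\<^sub>m n = 0\<^sub>m n n"
proof -
  obtain ev where ev: "((\<forall>i<n. ev i = 0) \<longrightarrow> T ^\<^sub>m n = 0\<^sub>m n n) \<and>
    (\<forall>\<phi>. (\<forall>x y. \<phi> (x - y) = \<phi> x - \<phi> y) \<longrightarrow>
      (\<exists>D\<in>carrier_mat n n. (\<forall>A\<in>W. D * A - A * D \<in> W) \<and>
        mat_trace n (T * D) = (\<Sum>i<n. ev i * \<phi> (ev i))))"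
    using twisted_semisimple_part[OF T W inv] by (rule exE)
  have "ev i = 0" if i: "i < n" for i
  proof (rule ccontr)
    assume "ev i \<noteq> 0"
    from rational_functional_exists[OF this]
    obtain \<phi> :: "'a \<Rightarrow> rat" where
      "(\<forall>x y. \<phi> (x - y) = \<phi> x - \<phi> y) \<and> (\<forall>q x. \<phi> (of_rat q * x) = q * \<phi> x) \<and> \<phi> (ev i) = 1"
      by (rule exE)
    then have \<phi>: "\<And>x y. \<phi> (x - y) = \<phi> x - \<phi> y"
      "\<And>q x. \<phi> (of_rat q * x) = q * \<phi> x" "\<phi> (ev i) = 1"
      by simp_all
    have z: "\<phi> 0 = 0" using \<phi>(1)[of 0 0] by simp
    have add: "\<phi> (x + y) = \<phi> x + \<phi> y" for x y
      using \<phi>(1)[of "x + y" y] by simp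
    have "\<exists>D\<in>carrier_mat n n. (\<forall>A\<in>W. D * A - A * D \<in> W) \<and>
        mat_trace n (T * D) = (\<Sum>i<n. ev i * of_rat (\<phi> (ev i)))"
      by (rule ev[THEN conjunct2, rule_format]) (simp add: \<phi>(1) of_rat_diff)
    then obtain D where D: "D \<in> carrier_mat n n" "\<forall>A\<in>W. D * A - A * D \<in> W"
      "mat_trace n (T * D) = (\<Sum>i<n. ev i * of_rat (\<phi> (ev i)))"
      by (elim bexE conjE)
    then have "(\<Sum>i<n. of_rat (\<phi> (ev i)) * ev i) = 0"
      using tr[OF D(1)] by (simp add: mult.commute)
    \<comment> \<open>A second application of \<phi> moves the equation into the rationals; the
      coefficients are rational, so they come out and leave a sum of squares.\<close>
    then have "\<phi> (\<Sum>i<n. of_rat (\<phi> (ev i)) * ev i) = 0" by (simp add: z)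
    moreover have "\<phi> (\<Sum>i\<in>F. of_rat (\<phi> (ev i)) * ev i) = (\<Sum>i\<in>F. (\<phi> (ev i))\<^sup>2)" if "finite F" for F
      using that by (induction F) (auto simp: z add \<phi>(2) power2_eq_square)
    ultimately have "(\<Sum>i<n. (\<phi> (ev i))\<^sup>2) = 0" by simp
    then have "(\<phi> (ev i))\<^sup>2 = 0" using i by (simp add: sum_nonneg_eq_0_iff)
    then show False using \<phi>(3) by simp
  qed
  then show ?thesis using ev[THEN conjunct1] by simp
qed

section \<open>Engel's theorem and perfect ideals\<close>

context lie_algebra
begin

lemma br_linear_right: "Vector_Spaces.linear sL sL (br x)"
  and br_linear_left: "Vector_Spaces.linear sL sL (\<lambda>x. br x y)"
  using br_bilinear by (auto simp: bilinear_map_def)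

lemmas br_simps =
  module_hom.add[OF linear_hom[OF br_linear_right]] module_hom.add[OF linear_hom[OF br_linear_left]]
  module_hom.diff[OF linear_hom[OF br_linear_right]] module_hom.diff[OF linear_hom[OF br_linear_left]]
  module_hom.scale[OF linear_hom[OF br_linear_right]] module_hom.scale[OF linear_hom[OF br_linear_left]]
  module_hom.neg[OF linear_hom[OF br_linear_right]] module_hom.neg[OF linear_hom[OF br_linear_left]]
  module_hom.zero[OF linear_hom[OF br_linear_right]] module_hom.zero[OF linear_hom[OF br_linear_left]]

lemma br_antisym: "br x y = - br y x"
proof -
  have "br (x + y) (x + y) = br x y + br y x"
    by (simp only: br_simps) (simp add: br_self)
  then show ?thesis by (simp add: br_self eq_neg_iff_add_eq_0)
qed

lemma br_br: "br x (br y z) = br (br x y) z + br y (br x z)"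
proof -
  have "br z (br x y) = - br (br x y) z" by (rule br_antisym)
  moreover have "br y (br z x) = - br y (br x z)"
    unfolding br_antisym[of z x] by (rule br_simps)
  ultimately have "br x (br y z) + - br y (br x z) + - br (br x y) z = 0"
    using jacobi[of x y z] by (simp only:)
  moreover have "a = c + b" if "a + - b + - c = 0" for a b c :: 'l
    using that by (simp add: algebra_simps)
  ultimately show ?thesis by blast
qed

lemma br_br_left: "br (br x y) z = br x (br y z) - br y (br x z)"
  unfolding br_br[of x y z] by simp

definition br_span :: "'l set \<Rightarrow> 'l set \<Rightarrow> 'l set"
  where "br_span M A = span {br x y | x y. x \<in> M \<and> y \<in> A}"

lemma derived_br_span: "derived A = br_span A A"
  by (simp add: derived_def br_span_def)

lemma subspace_br_span [simp]: "subspace (br_span M A)"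
  by (simp add: br_span_def)

lemma br_in_br_span: "x \<in> M \<Longrightarrow> y \<in> A \<Longrightarrow> br x y \<in> br_span M A"
  unfolding br_span_def by (rule span_base) blast

lemma br_span_subset:
  "subspace B \<Longrightarrow> (\<And>x y. x \<in> M \<Longrightarrow> y \<in> A \<Longrightarrow> br x y \<in> B) \<Longrightarrow> br_span M A \<subseteq> B"
  unfolding br_span_def by (rule span_minimal) auto

lemma br_span_mono: "M \<subseteq> N \<Longrightarrow> A \<subseteq> B \<Longrightarrow> br_span M A \<subseteq> br_span N B"
  unfolding br_span_def by (rule span_mono) blast

lemma br_span_pow_mono: "M \<subseteq> N \<Longrightarrow> A \<subseteq> B \<Longrightarrow> (br_span M ^^ k) A \<subseteq> (br_span N ^^ k) B"
  by (induction k) (simp_all add: br_span_mono)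

lemma subspace_br_span_pow: "subspace A \<Longrightarrow> subspace ((br_span M ^^ k) A)"
  by (cases k) auto

lemma br_span_pow_decreasing: "(br_span M ^^ Suc k) UNIV \<subseteq> (br_span M ^^ k) UNIV"
  by (induction k) (auto intro: br_span_mono[THEN subsetD])

text \<open>\<open>(br_span M ^^ k) UNIV\<close> is spanned by the values of products of
  \<open>k\<close> operators \<open>br m\<close>. The series starts from the whole algebra, so this
  is nilpotency of the associative algebra without unit generated by \<open>ad M\<close>.\<close>

definition ad_nilpotent :: "'l set \<Rightarrow> bool"
  where "ad_nilpotent M \<longleftrightarrow> (\<exists>k. (br_span M ^^ k) UNIV \<subseteq> {0})"

lemma pow_br_linear: "Vector_Spaces.linear sL sL (br y ^^ j)"
proof (induction j)
  case 0
  then show ?case using linear_id by (simp add: id_def)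
next
  case (Suc j)
  then show ?case
    unfolding funpow.simps by (rule Vector_Spaces.linear_compose[OF _ br_linear_right])
qed

text \<open>\<open>br y\<close> is a derivation:
  \<open>[y, [m, u]] = [[y, m], u] + [m, [y, u]]\<close>, where \<open>[y, m]\<close> is again in
  \<open>M\<close> and \<open>[y, u]\<close> is covered by induction.\<close>

lemma normalizing_preserves_br_span_pow:
  assumes M: "subspace M" and y: "\<And>m. m \<in> M \<Longrightarrow> br m y \<in> M"
  shows "v \<in> (br_span M ^^ k) UNIV \<Longrightarrow> br y v \<in> (br_span M ^^ k) UNIV"
proof (induction k arbitrary: v)
  case (Suc k)
  let ?U = "(br_span M ^^ k) UNIV"
  have "br_span M ?U \<subseteq> br y -` br_span M ?U"
  proof (rule br_span_subset)
    show "subspace (br y -` br_span M ?U)"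
      by (rule module_hom.subspace_vimage[OF linear_hom[OF br_linear_right]]) simp
    fix m u assume mu: "m \<in> M" "u \<in> ?U"
    have "br y m \<in> M" using y[OF mu(1)] subspace_neg[OF M] br_antisym[of y m] by simp
    then have "br (br y m) u + br m (br y u) \<in> br_span M ?U"
      using mu Suc.IH by (intro subspace_add br_in_br_span) auto
    then show "br m u \<in> br y -` br_span M ?U" unfolding vimage_eq br_br[of y m u] .
  qed
  then show ?case using Suc.prems by auto
qed simp

text \<open>Modulo the next term of the series, a product of \<open>j\<close> elements of \<open>M + ky\<close> acts as a multiple
  of the \<open>j\<close>-th power of \<open>y\<close>.\<close>

lemma br_span_insert_pow:
  assumes M: "subspace M" and y: "\<And>m. m \<in> M \<Longrightarrow> br m y \<in> M"
  shows "(br_span (span (insert y M)) ^^ j) ((br_span M ^^ k) UNIV) \<subseteq>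
    {(br y ^^ j) v + w | v w. v \<in> (br_span M ^^ k) UNIV \<and> w \<in> (br_span M ^^ Suc k) UNIV}"
proof (induction j)
  case 0
  have "0 \<in> (br_span M ^^ Suc k) UNIV" by (simp add: subspace_0)
  then have "v \<in> {(br y ^^ 0) v + w | v w. v \<in> (br_span M ^^ k) UNIV \<and> w \<in> (br_span M ^^ Suc k) UNIV}"
    if "v \<in> (br_span M ^^ k) UNIV" for v
    using that by (intro CollectI exI[of _ v] exI[of _ 0]) simp
  then show ?case by (auto simp only: funpow.simps id_apply)
next
  case (Suc j)
  let ?U = "(br_span M ^^ k) UNIV" and ?U' = "(br_span M ^^ Suc k) UNIV"
  let ?R = "\<lambda>j. {(br y ^^ j) v + w | v w. v \<in> ?U \<and> w \<in> ?U'}"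
  note lin = linear_hom[OF pow_br_linear]
  have sU: "subspace ?U" by (rule subspace_br_span_pow) simp
  have sU': "subspace ?U'" by simp
  have sub: "subspace (?R j)" for j
  proof (rule subspaceI)
    have "0 = (br y ^^ j) 0 + 0" by (simp add: module_hom.zero[OF lin])
    then show "0 \<in> ?R j" using subspace_0[OF sU] subspace_0[OF sU'] by blast
  next
    fix p q assume "p \<in> ?R j" "q \<in> ?R j"
    then obtain v w v' w' where *: "p = (br y ^^ j) v + w" "q = (br y ^^ j) v' + w'"
      "v \<in> ?U" "v' \<in> ?U" "w \<in> ?U'" "w' \<in> ?U'" by auto
    then have "p + q = (br y ^^ j) (v + v') + (w + w')"
      by (simp add: module_hom.add[OF lin])
    then show "p + q \<in> ?R j"
      using subspace_add[OF sU *(3,4)] subspace_add[OF sU' *(5,6)] by blast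
  next
    fix c p assume "p \<in> ?R j"
    then obtain v w where *: "p = (br y ^^ j) v + w" "v \<in> ?U" "w \<in> ?U'" by auto
    then have "sL c p = (br y ^^ j) (sL c v) + sL c w"
      by (simp add: module_hom.scale[OF lin] scale_right_distrib)
    then show "sL c p \<in> ?R j"
      using subspace_scale[OF sU *(2)] subspace_scale[OF sU' *(3)] by blast
  qed
  have yU: "(br y ^^ j) v \<in> ?U" if "v \<in> ?U" for v j
    using that normalizing_preserves_br_span_pow[OF M y] by (induction j) auto
  have "br_span (span (insert y M)) (?R j) \<subseteq> ?R (Suc j)"
  proof (rule br_span_subset[OF sub])
    fix z p assume "z \<in> span (insert y M)" "p \<in> ?R j"
    then obtain c v w where c: "z - sL c y \<in> M" and p: "p = (br y ^^ j) v + w"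
      and v: "v \<in> ?U" and w: "w \<in> ?U'"
      using M by (auto simp: span_insert span_eq_iff[THEN iffD2])
    let ?m = "z - sL c y"
    have "w \<in> ?U" using w br_span_pow_decreasing by blast
    \<comment> \<open>Elements of \<open>M\<close> move \<open>?U\<close> one step down into
      \<open>?U'\<close>, while \<open>y\<close> preserves each term of the series; so only the
      power of \<open>y\<close> survives modulo \<open>?U'\<close>.\<close>
    have 1: "br ?m ((br y ^^ j) v) \<in> ?U'" "br ?m w \<in> ?U'"
      using c yU[OF v] \<open>w \<in> ?U\<close> by (auto intro: br_in_br_span)
    have 2: "sL c (br y w) \<in> ?U'"
      using normalizing_preserves_br_span_pow[OF M y w] subspace_scale[OF sU'] by blast
    have "br z p = br (sL c y + ?m) ((br y ^^ j) v + w)" using p by simp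
    also have "\<dots> = (br y ^^ Suc j) (sL c v) + (br ?m ((br y ^^ j) v) + br ?m w + sL c (br y w))"
      unfolding funpow.simps o_def
      by (simp only: br_simps module_hom.scale[OF lin]) (simp add: scale_right_distrib algebra_simps)
    finally show "br z p \<in> ?R (Suc j)"
      using subspace_scale[OF sU v] subspace_add[OF sU' subspace_add[OF sU' 1] 2] by blast
  qed
  then show ?case
    using br_span_mono[OF order_refl Suc] by (auto simp: subset_iff)
qed

text \<open>Since the \<open>r\<close>-th power of \<open>br y\<close> vanishes, \<open>r\<close>
  factors from the enlarged space descend one step in the series of \<open>M\<close>; this accounts
  for the exponent \<open>r * k\<close>.\<close>

lemma ad_nilpotent_insert:
  assumes M: "subspace M" and y: "\<And>m. m \<in> M \<Longrightarrow> br m y \<in> M"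
    and r: "\<And>v. (br y ^^ r) v = 0" and nil: "ad_nilpotent M"
  shows "ad_nilpotent (span (insert y M))"
proof -
  let ?N = "span (insert y M)"
  obtain k where k: "(br_span M ^^ k) UNIV \<subseteq> {0}" using nil by (auto simp: ad_nilpotent_def)
  have "(br_span ?N ^^ (r * k)) UNIV \<subseteq> (br_span M ^^ k) UNIV" for k
  proof (induction k)
    case (Suc k)
    have "(br_span ?N ^^ (r * Suc k)) UNIV = (br_span ?N ^^ r) ((br_span ?N ^^ (r * k)) UNIV)"
      by (simp add: funpow_add)
    also have "\<dots> \<subseteq> (br_span ?N ^^ r) ((br_span M ^^ k) UNIV)"
      by (rule br_span_pow_mono[OF order_refl Suc])
    also have "\<dots> \<subseteq> (br_span M ^^ Suc k) UNIV"
      using br_span_insert_pow[OF M y, of r k] by (auto simp: r)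
    finally show ?case .
  qed simp
  then show ?thesis using k unfolding ad_nilpotent_def by blast
qed

text \<open>Because \<open>[y, y] = 0\<close> and \<open>[M, y]\<close> is in \<open>M\<close>, all
  brackets even fall into \<open>M\<close> itself.\<close>

lemma br_closed_insert:
  assumes M: "lie_subalgebra M" and y: "\<And>m. m \<in> M \<Longrightarrow> br m y \<in> M"
  shows "lie_subalgebra (span (insert y M))"
proof -
  have sM: "subspace M" using M by (simp add: lie_subalgebra_def)
  have "br p q \<in> span (insert y M)" if pq: "p \<in> span (insert y M)" "q \<in> span (insert y M)" for p q
  proof -
    obtain c d where cd: "p - sL c y \<in> M" "q - sL d y \<in> M"
      using pq sM by (auto simp: span_insert span_eq_iff[THEN iffD2])
    let ?m = "p - sL c y" and ?n = "q - sL d y"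
    have *: "br (sL c y + m) (sL d y + n) = br m n + (sL d (br m y) - sL c (br n y))" for m n
      by (simp only: br_simps br_self br_antisym[of y n]) (simp add: algebra_simps)
    have "br p q = br (sL c y + ?m) (sL d y + ?n)" by simp
    also have "\<dots> = br ?m ?n + (sL d (br ?m y) - sL c (br ?n y))" by (rule *)
    also have "\<dots> \<in> M"
      using M cd y by (intro subspace_add subspace_diff subspace_scale sM) (auto simp: lie_subalgebra_def)
    finally show ?thesis by (simp add: span_base)
  qed
  then show ?thesis by (simp add: lie_subalgebra_def)
qed

text \<open>Perfectness keeps \<open>P\<close> inside every term of the series, the zero term
  included.\<close>

lemma perfect_ad_nilpotent:
  assumes "derived P = P" "ad_nilpotent P"
  shows "P \<subseteq> {0}"
proof -
  have "P \<subseteq> (br_span P ^^ k) UNIV" for k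
  proof (induction k)
    case (Suc k)
    show ?case
      using br_span_mono[OF order_refl Suc, of P] assms(1) by (simp add: derived_br_span)
  qed simp
  then show ?thesis using assms(2) by (auto simp: ad_nilpotent_def)
qed

section \<open>Derived ideals and centralizers\<close>

lemma lie_ideal_subalgebra: "lie_ideal A I \<Longrightarrow> lie_subalgebra I"
  by (auto simp: lie_ideal_def lie_subalgebra_def)

lemma lie_ideal_derived:
  assumes I: "lie_ideal UNIV I"
  shows "lie_ideal UNIV (derived I)" "derived I \<subseteq> I"
proof -
  show "derived I \<subseteq> I"
    unfolding derived_br_span using I by (intro br_span_subset) (auto simp: lie_ideal_def)
  have "derived I \<subseteq> br a -` derived I" for a
    unfolding derived_br_span
  proof (rule br_span_subset)
    show "subspace (br a -` br_span I I)"
      by (rule module_hom.subspace_vimage[OF linear_hom[OF br_linear_right]]) simp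
    fix x y assume xy: "x \<in> I" "y \<in> I"
    have "br (br a x) y + br x (br a y) \<in> br_span I I"
      using xy I by (intro subspace_add br_in_br_span) (auto simp: lie_ideal_def)
    then show "br x y \<in> br a -` br_span I I" unfolding vimage_eq br_br[of a x y] .
  qed
  then show "lie_ideal UNIV (derived I)" by (auto simp: lie_ideal_def derived_br_span)
qed

lemma solvable_derived: "solvable (derived A) \<Longrightarrow> solvable A"
  unfolding solvable_def using funpow_swap1[of derived] by (metis funpow.simps(2) o_apply)

definition centralizer :: "'l set \<Rightarrow> 'l set"
  where "centralizer I = {x. \<forall>a\<in>I. br x a = 0}"

lemma subspace_centralizer: "subspace (centralizer I)"
  by (rule subspaceI) (auto simp: centralizer_def br_simps)

lemma lie_ideal_centralizer:
  assumes "lie_ideal UNIV I" shows "lie_ideal UNIV (centralizer I)"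
  using assms subspace_centralizer
  by (auto simp: lie_ideal_def centralizer_def br_br_left br_simps)

text \<open>The intersection is an abelian ideal, hence solvable at the first derived step.\<close>

lemma semisimple_inter_centralizer:
  assumes ss: semisimple and I: "lie_ideal UNIV I"
  shows "I \<inter> centralizer I = {0}"
proof -
  have "lie_ideal UNIV (I \<inter> centralizer I)"
    using I lie_ideal_centralizer[OF I] by (auto simp: lie_ideal_def subspace_inter)
  moreover have "derived (I \<inter> centralizer I) \<subseteq> {0}"
    unfolding derived_br_span by (rule br_span_subset) (auto simp: centralizer_def)
  then have "derived (I \<inter> centralizer I) = {0}"
    using subspace_0[OF subspace_br_span] by (auto simp: derived_br_span)
  then have "solvable (I \<inter> centralizer I)"
    unfolding solvable_def by (intro exI[of _ 1]) simp
  ultimately show ?thesis using ss unfolding semisimple_def by blast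
qed

end

locale fd_lie_algebra = lie_algebra sL br + finite_dimensional_vector_space sL Basis
  for sL :: "'k::field_char_0 \<Rightarrow> 'l::ab_group_add \<Rightarrow> 'l" and br Basis
begin

text \<open>A subalgebra \<open>M\<close> of \<open>P\<close> of largest dimension among those
  acting nilpotently must be \<open>P\<close>: otherwise a vector of \<open>P\<close> outside
  \<open>M\<close> normalizes it and enlarges it. The series \<open>?V\<close> finds that vector
  without passing to the quotient by \<open>M\<close>.\<close>

lemma engel:
  assumes P: "lie_subalgebra P" and nil: "\<And>x. x \<in> P \<Longrightarrow> \<exists>r. \<forall>v. (br x ^^ r) v = 0"
  shows "ad_nilpotent P"
proof -
  let ?Q = "\<lambda>M. M \<subseteq> P \<and> lie_subalgebra M \<and> ad_nilpotent M"
  have "br_span {0} UNIV \<subseteq> {0}"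
    by (rule br_span_subset) (auto simp: br_simps)
  then have "?Q {0}"
    using P by (auto simp: lie_subalgebra_def subspace_0 br_self ad_nilpotent_def intro!: exI[of _ 1])
  moreover have "\<forall>M. ?Q M \<longrightarrow> dim M \<le> dimension"
    by (auto intro: dim_subset_UNIV)
  ultimately obtain M where M: "?Q M" and max: "\<And>N. ?Q N \<Longrightarrow> dim N \<le> dim M"
    using ex_has_greatest_nat[of ?Q "{0}" dim "Suc dimension"] by (auto simp: less_Suc_eq_le)
  have sM: "subspace M" and sP: "subspace P" using M P by (auto simp: lie_subalgebra_def)
  have "P \<subseteq> M"
  proof (rule ccontr)
    assume notsub: "\<not> P \<subseteq> M"
    let ?V = "\<lambda>j. (br_span M ^^ j) P"
    obtain k where "(br_span M ^^ k) UNIV \<subseteq> {0}" using M by (auto simp: ad_nilpotent_def)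
    then have "?V k \<subseteq> M"
      using br_span_pow_mono[of M M P UNIV k] subspace_0[OF sM] by auto
    \<comment> \<open>The first term inside \<open>M\<close> has a predecessor, because
      \<open>?V 0\<close> is \<open>P\<close>. A vector \<open>y\<close> of the predecessor outside
      \<open>M\<close> is the one sought, since its brackets with \<open>M\<close> fall into the
      next term.\<close>
    then have "?V (LEAST k. ?V k \<subseteq> M) \<subseteq> M" by (rule LeastI)
    then obtain j where j: "(LEAST k. ?V k \<subseteq> M) = Suc j" "?V (Suc j) \<subseteq> M"
      using notsub by (cases "LEAST k. ?V k \<subseteq> M") auto
    then have "\<not> ?V j \<subseteq> M" using not_less_Least[of j "\<lambda>k. ?V k \<subseteq> M"] by simp
    then obtain y where y: "y \<in> ?V j" "y \<notin> M" by auto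
    have "?V j \<subseteq> P" for j
    proof (induction j)
      case (Suc j)
      have "br_span M (?V j) \<subseteq> P"
        using M P Suc by (intro br_span_subset sP) (auto simp: lie_subalgebra_def)
      then show ?case by simp
    qed simp
    then have yP: "y \<in> P" using y by blast
    have norm: "br m y \<in> M" if "m \<in> M" for m
      using that y j(2) br_in_br_span[of m M y "?V j"] by auto
    let ?N = "span (insert y M)"
    obtain r where "\<And>v. (br y ^^ r) v = 0" using nil[OF yP] by auto
    then have "ad_nilpotent ?N" using ad_nilpotent_insert[OF sM norm] M by blast
    moreover have "lie_subalgebra ?N" using br_closed_insert[OF _ norm] M by blast
    moreover have "?N \<subseteq> P" using yP M by (intro span_minimal sP) auto
    ultimately have "dim ?N \<le> dim M" by (intro max) auto
    moreover have "M \<subseteq> ?N" by (auto intro: span_base)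
    ultimately have "M = ?N"
      by (intro subspace_dim_equal sM) auto
    then show False using y span_base[of y "insert y M"] by auto
  qed
  then show ?thesis using M by (metis subset_antisym)
qed

text \<open>Passing to the derived ideal lowers the dimension until the ideal is perfect, and it
  preserves nonsolvability, so the result is nonzero.\<close>

lemma perfect_ideal_exists:
  assumes "lie_ideal UNIV I" "\<not> solvable I"
  shows "\<exists>P\<subseteq>I. lie_ideal UNIV P \<and> derived P = P \<and> P \<noteq> {0}"
  using assms
proof (induction "dim I" arbitrary: I rule: less_induct)
  case less
  show ?case
  proof (cases "derived I = I")
    case True
    have "solvable {0}" unfolding solvable_def by (rule exI[of _ 0]) simp
    then have "I \<noteq> {0}" using less.prems(2) by auto
    then show ?thesis using True less.prems(1) by blast
  next
    case False
    note d = lie_ideal_derived[OF less.prems(1)]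
    have "dim (derived I) < dim I"
    proof (rule ccontr)
      assume "\<not> dim (derived I) < dim I"
      then have "derived I = I"
        using d less.prems(1) by (intro subspace_dim_equal) (auto simp: lie_ideal_def)
      then show False using False by simp
    qed
    moreover have "\<not> solvable (derived I)"
      using less.prems(2) solvable_derived[of I] by blast
    ultimately show ?thesis using less.hyps[of "derived I"] d by blast
  qed
qed

end

section \<open>The Killing form of a semisimple Lie algebra\<close>

context fd_lie_algebra
begin

section \<open>Matrices of operators over the algebraic closure\<close>

definition basis_enum :: "nat \<Rightarrow> 'l"
  where "basis_enum = (SOME b. bij_betw b {..<dimension} Basis)"

lemma bij_basis_enum: "bij_betw basis_enum {..<dimension} Basis"
proof -
  have "\<exists>b. bij_betw b {..<dimension} Basis"
    using ex_bij_betw_nat_finite[OF finite_Basis] by (simp add: dimension_def atLeast0LessThan)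
  then show ?thesis unfolding basis_enum_def by (rule someI_ex)
qed

lemma sum_Basis: "(\<Sum>b\<in>Basis. f b) = (\<Sum>i<dimension. f (basis_enum i))"
  by (rule sum.reindex_bij_betw[OF bij_basis_enum, symmetric])

lemma mem_span_Basis: "v \<in> span Basis"
  by (simp add: span_Basis)

lemmas coord_simps =
  representation_add[OF independent_Basis mem_span_Basis mem_span_Basis]
  representation_diff[OF independent_Basis mem_span_Basis mem_span_Basis]
  representation_scale[OF independent_Basis mem_span_Basis]

lemma coord_sum_eq: "(\<Sum>b\<in>Basis. sL (representation Basis v b) b) = v"
  by (rule sum_representation_eq[OF independent_Basis mem_span_Basis finite_Basis order_refl])

lemma coord_linear_apply:
  assumes f: "Vector_Spaces.linear sL sL f"
  shows "representation Basis (f v) c = (\<Sum>b\<in>Basis. representation Basis v b * representation Basis (f b) c)"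
proof -
  note hom = linear_hom[OF f]
  have "f v = f (\<Sum>b\<in>Basis. sL (representation Basis v b) b)" by (simp only: coord_sum_eq)
  also have "\<dots> = (\<Sum>b\<in>Basis. sL (representation Basis v b) (f b))"
    by (simp only: module_hom.sum[OF hom] module_hom.scale[OF hom])
  finally show ?thesis
    by (simp add: representation_sum[OF independent_Basis mem_span_Basis] coord_simps)
qed

definition op_mat :: "('l \<Rightarrow> 'l) \<Rightarrow> 'k alg_closure mat"
  where "op_mat f = mat dimension dimension
    (\<lambda>(i, j). to_ac (representation Basis (f (basis_enum j)) (basis_enum i)))"

lemma op_mat_carrier [simp]: "op_mat f \<in> carrier_mat dimension dimension"
  by (simp add: op_mat_def)

lemma op_mat_dim [simp]: "dim_row (op_mat f) = dimension" "dim_col (op_mat f) = dimension"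
  by (simp_all add: op_mat_def)

lemma op_mat_comp:
  assumes "Vector_Spaces.linear sL sL f"
  shows "op_mat (\<lambda>v. f (g v)) = op_mat f * op_mat g"
proof (rule eq_matI)
  fix i j assume "i < dim_row (op_mat f * op_mat g)" "j < dim_col (op_mat f * op_mat g)"
  then have ij: "i < dimension" "j < dimension" by simp_all
  have "op_mat (\<lambda>v. f (g v)) $$ (i, j) =
      to_ac (\<Sum>k<dimension. representation Basis (g (basis_enum j)) (basis_enum k) *
        representation Basis (f (basis_enum k)) (basis_enum i))"
    using ij coord_linear_apply[OF assms, of "g (basis_enum j)" "basis_enum i"]
    by (simp add: op_mat_def sum_Basis)
  also have "\<dots> = (op_mat f * op_mat g) $$ (i, j)"
    unfolding index_mult_mat_sum[OF op_mat_carrier op_mat_carrier ij]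
    using ij by (simp add: op_mat_def to_ac_sum mult.commute)
  finally show "op_mat (\<lambda>v. f (g v)) $$ (i, j) = (op_mat f * op_mat g) $$ (i, j)" .
qed simp_all

lemma op_mat_diff: "op_mat (\<lambda>v. f v - g v) = op_mat f - op_mat g"
  by (rule eq_matI) (auto simp: op_mat_def coord_simps)

lemma op_mat_id: "op_mat (\<lambda>v. v) = 1\<^sub>m dimension"
proof (rule eq_matI)
  fix i j assume "i < dim_row (1\<^sub>m dimension)" "j < dim_col (1\<^sub>m dimension)"
  then have ij: "i < dimension" "j < dimension" by simp_all
  have b: "basis_enum j \<in> Basis" using bij_basis_enum ij by (auto simp: bij_betw_def)
  have "basis_enum i = basis_enum j \<longleftrightarrow> i = j"
    using bij_basis_enum ij by (auto simp: bij_betw_def inj_on_def)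
  then show "op_mat (\<lambda>v. v) $$ (i, j) = 1\<^sub>m dimension $$ (i, j)"
    using ij by (auto simp: op_mat_def representation_basis[OF independent_Basis b])
qed simp_all

lemma op_mat_br_pow: "op_mat (br x ^^ k) = op_mat (br x) ^\<^sub>m k"
proof (induction k)
  case (Suc k)
  have eq: "br x ^^ Suc k = (\<lambda>v. (br x ^^ k) (br x v))"
    by (simp only: funpow_Suc_right o_def)
  have "op_mat (br x ^^ Suc k) = op_mat (br x ^^ k) * op_mat (br x)"
    unfolding eq by (rule op_mat_comp[OF pow_br_linear])
  then show ?case by (simp only: Suc pow_mat.simps)
qed (simp add: op_mat_id id_def)

lemma op_mat_eq_0:
  assumes f: "Vector_Spaces.linear sL sL f" and z: "op_mat f = 0\<^sub>m dimension dimension"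
  shows "f v = 0"
proof -
  have "representation Basis (f b) c = 0" if bc: "b \<in> Basis" "c \<in> Basis" for b c
  proof -
    have "b \<in> basis_enum ` {..<dimension}" "c \<in> basis_enum ` {..<dimension}"
      using bc by (simp_all add: bij_betw_imp_surj_on[OF bij_basis_enum])
    then obtain i j where "j < dimension" "i < dimension" "b = basis_enum j" "c = basis_enum i"
      by auto
    then have "to_ac (representation Basis (f b) c) = op_mat f $$ (i, j)" by (simp add: op_mat_def)
    also have "\<dots> = 0" unfolding z using \<open>j < dimension\<close> \<open>i < dimension\<close> by simp
    finally show ?thesis by simp
  qed
  then have "representation Basis (f v) c = 0" if "c \<in> Basis" for c
    unfolding coord_linear_apply[OF f, of v c] using that by simp
  then have "(\<Sum>c\<in>Basis. sL (representation Basis (f v) c) c) = 0"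
    by (intro sum.neutral ballI) simp
  then show ?thesis unfolding coord_sum_eq .
qed

section \<open>The Killing form and Cartan's criterion\<close>

definition killing :: "'l \<Rightarrow> 'l \<Rightarrow> 'k"
  where "killing x y = (\<Sum>b\<in>Basis. representation Basis (br x (br y b)) b)"

abbreviation "ad_mat x \<equiv> op_mat (br x)"

lemma ad_mat_br: "ad_mat (br x y) = ad_mat x * ad_mat y - ad_mat y * ad_mat x"
proof -
  have eq: "br (br x y) = (\<lambda>v. br x (br y v) - br y (br x v))"
    by (rule ext) (rule br_br_left)
  show ?thesis
    unfolding eq op_mat_diff
      op_mat_comp[OF br_linear_right, of x "br y"] op_mat_comp[OF br_linear_right, of y "br x"] ..
qed

text \<open>As \<open>to_ac\<close> is injective, symmetry and invariance can be read off from
  matrix traces.\<close>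

lemma killing_trace: "to_ac (killing x y) = mat_trace dimension (ad_mat x * ad_mat y)"
  unfolding op_mat_comp[OF br_linear_right, symmetric]
  by (simp add: mat_trace_def op_mat_def killing_def sum_Basis to_ac_sum)

lemma killing_commute: "killing x y = killing y x"
proof -
  have "to_ac (killing x y) = to_ac (killing y x)"
    unfolding killing_trace by (rule mat_trace_comm) simp_all
  then show ?thesis by simp
qed

lemma killing_linear:
  "killing (x + y) z = killing x z + killing y z"
  "killing (x - y) z = killing x z - killing y z"
  "killing (sL c x) z = c * killing x z"
  by (simp_all add: killing_def br_simps coord_simps sum.distrib sum_subtractf sum_distrib_left)

lemma killing_linear_right:
  "killing z (x + y) = killing z x + killing z y"
  "killing z (x - y) = killing z x - killing z y"
  "killing z (sL c x) = c * killing z x"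
  using killing_linear by (simp_all add: killing_commute[of z])

text \<open>Cyclicity matches the subtracted terms: \<open>tr (B A C) = tr (A C B)\<close>.\<close>

lemma mat_trace_commutator:
  fixes A :: "'c::comm_ring_1 mat"
  assumes A: "A \<in> carrier_mat n n" "B \<in> carrier_mat n n" "C \<in> carrier_mat n n"
  shows "mat_trace n ((A * B - B * A) * C) = mat_trace n (A * (B * C - C * B))"
proof -
  have "mat_trace n ((A * B - B * A) * C) = mat_trace n (A * B * C) - mat_trace n (B * A * C)"
    using A by (simp add: minus_mult_distrib_mat[of _ n n _ _ n] mat_trace_linear(2)[of _ n])
  also have "mat_trace n (B * A * C) = mat_trace n (A * C * B)"
    using mat_trace_comm[of B n "A * C"] A by simp
  also have "mat_trace n (A * B * C) - mat_trace n (A * C * B) = mat_trace n (A * (B * C - C * B))"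
    using A by (simp add: mult_minus_distrib_mat[of _ n n _ n] mat_trace_linear(2)[of _ n])
  finally show ?thesis .
qed

lemma commutator_carrier_mat [simp]:
  "A \<in> carrier_mat n n \<Longrightarrow> B \<in> carrier_mat n n \<Longrightarrow> A * B - B * A \<in> carrier_mat n n"
  by (intro minus_carrier_mat mult_carrier_mat)

lemma killing_invariant: "killing (br x y) z = killing x (br y z)"
proof -
  have "to_ac (killing (br x y) z) = to_ac (killing x (br y z))"
    unfolding killing_trace ad_mat_br by (rule mat_trace_commutator) simp_all
  then show ?thesis by simp
qed

lemma killing_zero_imp_ad_nilpotent:
  assumes P: "lie_subalgebra P" "derived P = P" and kill: "\<And>x y. x \<in> P \<Longrightarrow> y \<in> P \<Longrightarrow> killing x y = 0"
    and x: "x \<in> P"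
  shows "(br x ^^ dimension) v = 0"
proof -
  let ?n = dimension
  define W where "W = {w \<in> carrier_mat ?n ?n. \<forall>b\<in>P. mat_trace ?n (w * ad_mat b) = 0}"
  have W: "mat_subspace ?n W"
    unfolding mat_subspace_def
  proof (intro conjI ballI allI)
    show "0\<^sub>m ?n ?n \<in> W"
      by (auto simp: W_def left_mult_zero_mat[of _ ?n ?n] mat_trace_def)
  next
    fix A B assume "A \<in> W" "B \<in> W"
    then show "A + B \<in> W"
      by (auto simp: W_def add_mult_distrib_mat[of _ ?n ?n _ _ ?n] mat_trace_linear(1)[of _ ?n])
  next
    fix A c assume "A \<in> W"
    then show "c \<cdot>\<^sub>m A \<in> W"
      by (auto simp: W_def mult_smult_assoc_mat[of _ ?n ?n _ ?n] mat_trace_linear(3)[of _ ?n])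
  qed (auto simp: W_def)
  have ad_W: "ad_mat a \<in> W" if "a \<in> P" for a
    using kill[OF that] by (auto simp: W_def simp flip: killing_trace)
  \<comment> \<open>Moved across the trace form, the bracket with \<open>ad x\<close> becomes
    \<open>ad [b, x]\<close>, and \<open>P\<close> is closed under brackets.\<close>
  have inv: "ad_mat x * w - w * ad_mat x \<in> W" if w: "w \<in> W" for w
  proof -
    have wc: "w \<in> carrier_mat ?n ?n" using w by (simp add: W_def)
    have "mat_trace ?n ((ad_mat x * w - w * ad_mat x) * ad_mat b) = 0" if b: "b \<in> P" for b
    proof -
      have "mat_trace ?n ((ad_mat x * w - w * ad_mat x) * ad_mat b) =
          mat_trace ?n (ad_mat x * (w * ad_mat b - ad_mat b * w))"
        using wc by (intro mat_trace_commutator) simp_all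
      also have "\<dots> = mat_trace ?n ((w * ad_mat b - ad_mat b * w) * ad_mat x)"
        using wc by (intro mat_trace_comm) simp_all
      also have "\<dots> = mat_trace ?n (w * (ad_mat b * ad_mat x - ad_mat x * ad_mat b))"
        using wc by (intro mat_trace_commutator) simp_all
      also have "\<dots> = 0"
        unfolding ad_mat_br[symmetric] using w P(1) b x by (auto simp: W_def lie_subalgebra_def)
      finally show ?thesis .
    qed
    then show ?thesis using wc by (auto simp: W_def)
  qed
  have "ad_mat x ^\<^sub>m ?n = 0\<^sub>m ?n ?n"
  proof (rule nilpotent_if_trace_condition[OF op_mat_carrier W inv])
    fix D :: "'k alg_closure mat"
    assume D: "D \<in> carrier_mat ?n ?n" and DW: "\<And>A. A \<in> W \<Longrightarrow> D * A - A * D \<in> W"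
    \<comment> \<open>By perfectness \<open>x\<close> is a combination of brackets, so the condition
      is checked on brackets of elements of \<open>P\<close> and extended linearly.\<close>
    let ?Z = "{a. mat_trace ?n (ad_mat a * D) = 0}"
    have add: "ad_mat (a + b) = ad_mat a + ad_mat b" for a b
      by (rule eq_matI) (auto simp: op_mat_def br_simps coord_simps)
    have sc: "ad_mat (sL c a) = to_ac c \<cdot>\<^sub>m ad_mat a" for a c
      by (rule eq_matI) (auto simp: op_mat_def br_simps coord_simps)
    have zero: "ad_mat 0 = 0\<^sub>m ?n ?n"
      by (rule eq_matI) (auto simp: op_mat_def br_simps representation_zero)
    have "subspace ?Z"
    proof (rule subspaceI)
      show "0 \<in> ?Z" using D by (simp add: zero left_mult_zero_mat[of _ ?n ?n] mat_trace_def)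
    next
      fix a b assume "a \<in> ?Z" "b \<in> ?Z"
      then show "a + b \<in> ?Z"
        using D by (simp add: add add_mult_distrib_mat[of _ ?n ?n _ _ ?n] mat_trace_linear(1)[of _ ?n]
            mult_carrier_mat[of _ ?n ?n _ ?n])
    next
      fix c a assume "a \<in> ?Z"
      then show "sL c a \<in> ?Z"
        using D by (simp add: sc mult_smult_assoc_mat[of _ ?n ?n _ ?n] mat_trace_linear(3)[of _ ?n]
            mult_carrier_mat[of _ ?n ?n _ ?n])
    qed
    moreover have "br a b \<in> ?Z" if "a \<in> P" "b \<in> P" for a b
    proof -
      have "mat_trace ?n (ad_mat (br a b) * D) = mat_trace ?n (D * ad_mat (br a b))"
        using D by (intro mat_trace_comm) simp_all
      also have "\<dots> = mat_trace ?n (D * (ad_mat a * ad_mat b - ad_mat b * ad_mat a))"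
        unfolding ad_mat_br ..
      also have "\<dots> = mat_trace ?n ((D * ad_mat a - ad_mat a * D) * ad_mat b)"
        using D by (intro mat_trace_commutator[symmetric]) simp_all
      also have "\<dots> = 0" using DW[OF ad_W[OF that(1)]] that(2) by (auto simp: W_def)
      finally show ?thesis by simp
    qed
    ultimately have "derived P \<subseteq> ?Z"
      unfolding derived_br_span by (rule br_span_subset)
    then show "mat_trace ?n (ad_mat x * D) = 0" using x P(2) by auto
  qed
  then have "op_mat (br x ^^ ?n) = 0\<^sub>m ?n ?n" by (simp add: op_mat_br_pow)
  then show ?thesis by (rule op_mat_eq_0[OF pow_br_linear])
qed

section \<open>Splitting off an ideal of a semisimple algebra\<close>

definition perp :: "'l set \<Rightarrow> 'l set"
  where "perp I = {x. \<forall>y\<in>I. killing x y = 0}"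

lemma subspace_perp: "subspace (perp I)"
proof (rule subspaceI)
  show "0 \<in> perp I" using killing_linear(3)[of 0 0] by (simp add: perp_def)
qed (auto simp: perp_def killing_linear)

lemma lie_ideal_perp:
  assumes I: "lie_ideal UNIV I" shows "lie_ideal UNIV (perp I)"
proof -
  have "killing (br a x) y = 0" if "x \<in> perp I" "y \<in> I" for a x y
  proof -
    have "killing (br a x) y = - killing (br x a) y"
      using killing_linear(3)[of "-1" "br x a" y] br_antisym[of a x] by simp
    also have "\<dots> = - killing x (br a y)" by (simp add: killing_invariant)
    also have "\<dots> = 0" using I that by (auto simp: lie_ideal_def perp_def)
    finally show ?thesis .
  qed
  then show ?thesis using subspace_perp by (auto simp: lie_ideal_def perp_def)
qed

lemma semisimple_inter_perp:
  assumes ss: semisimple and I: "lie_ideal UNIV I"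
  shows "I \<inter> perp I = {0}"
proof -
  let ?J = "I \<inter> perp I"
  have J: "lie_ideal UNIV ?J"
    using I lie_ideal_perp[OF I] by (auto simp: lie_ideal_def subspace_inter)
  have "solvable ?J"
  proof (rule ccontr)
    assume "\<not> solvable ?J"
    then obtain P where P: "P \<subseteq> ?J" "lie_ideal UNIV P" "derived P = P" "P \<noteq> {0}"
      using perfect_ideal_exists[OF J] by blast
    have "killing x y = 0" if "x \<in> P" "y \<in> P" for x y
      using that P(1) by (auto simp: perp_def)
    from killing_zero_imp_ad_nilpotent[OF lie_ideal_subalgebra[OF P(2)] P(3) this]
    have "ad_nilpotent P"
      by (intro engel lie_ideal_subalgebra[OF P(2)]) blast
    then have "P \<subseteq> {0}" by (rule perfect_ad_nilpotent[OF P(3)])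
    moreover have "0 \<in> P" using P(2) subspace_0 by (auto simp: lie_ideal_def)
    ultimately show False using P(4) by auto
  qed
  then show ?thesis using J ss unfolding semisimple_def by blast
qed

text \<open>Nondegeneracy on \<open>I\<close> yields \<open>x\<close> in \<open>I\<close> inducing
  the same functional on \<open>I\<close> as \<open>v\<close>. Then \<open>v - x\<close> is in
  \<open>perp I\<close>, and its brackets with \<open>I\<close> lie in both ideals \<open>I\<close>
  and \<open>perp I\<close>, hence vanish.\<close>

lemma semisimple_decompose:
  assumes ss: semisimple and I: "lie_ideal UNIV I"
  shows "\<exists>x\<in>I. v - x \<in> centralizer I"
proof -
  have sI: "subspace I" using I by (simp add: lie_ideal_def)
  obtain E where E: "E \<subseteq> I" "independent E" "I \<subseteq> span E" "card E = dim I"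
    by (rule basis_exists)
  have fE: "finite E" using E(2) by (rule finiteI_independent)
  have spE: "span E = I" using E span_minimal[OF E(1) sI] by auto
  \<comment> \<open>\<open>F v\<close> stores the functional \<open>killing v\<close> on
    \<open>I\<close> as an element of \<open>I\<close>, with its values on \<open>E\<close> as
    coordinates. The kernel is \<open>perp I\<close>, so \<open>F\<close> is injective on
    \<open>I\<close> and, by dimension, onto \<open>I\<close>.\<close>
  define F where "F v = (\<Sum>e\<in>E. sL (killing v e) e)" for v
  have F: "Vector_Spaces.linear sL sL F"
    by unfold_locales
      (simp_all add: F_def killing_linear scale_left_distrib sum.distrib scale_sum_right)
  interpret F: Vector_Spaces.linear sL sL F by (rule F)
  have FI: "F v \<in> I" for v
    unfolding F_def using E(1) by (intro subspace_sum sI subspace_scale) auto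
  have perp: "v \<in> perp I" if "F v = 0" for v
  proof -
    have 0: "killing v e = 0" if "e \<in> E" for e
      using independentD[OF E(2) fE order_refl _ that, of "killing v"] \<open>F v = 0\<close> by (simp add: F_def)
    have "subspace {y. killing v y = 0}"
      by (rule subspaceI) (use killing_linear_right(3)[of v 0 0] in \<open>auto simp: killing_linear_right\<close>)
    then have "span E \<subseteq> {y. killing v y = 0}" using 0 by (intro span_minimal) auto
    then show ?thesis using spE by (auto simp: perp_def)
  qed
  have zero: "x = 0" if "x \<in> I" "F x = 0" for x
    using that perp[of x] semisimple_inter_perp[OF ss I] by auto
  have inj: "inj_on F I"
  proof (rule inj_onI)
    fix x y assume "x \<in> I" "y \<in> I" "F x = F y"
    then show "x = y" using zero[of "x - y"] subspace_diff[OF sI] by (simp add: F.diff)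
  qed
  interpret vp: vector_space_pair sL sL by unfold_locales
  have "independent (F ` E)"
    using vp.linear_independent_injective_image[OF F E(2)] inj spE by simp
  moreover have "card (F ` E) = dim I"
    using E(1,4) inj by (simp add: card_image inj_on_subset)
  ultimately have "I \<subseteq> span (F ` E)"
    using FI by (intro card_ge_dim_independent) auto
  then have "I \<subseteq> F ` I" using spE by (simp add: F.span_image)
  then obtain x where x: "x \<in> I" "F v = F x" using FI[of v] by auto
  then have vx: "v - x \<in> perp I" by (intro perp) (simp add: F.diff)
  have "br (v - x) a = 0" if a: "a \<in> I" for a
  proof -
    have "br (v - x) a \<in> I" using I a by (auto simp: lie_ideal_def)
    moreover have "br a (v - x) \<in> perp I"
      using lie_ideal_perp[OF I] vx by (auto simp: lie_ideal_def)
    then have "br (v - x) a \<in> perp I"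
      using subspace_neg[OF subspace_perp] br_antisym[of "v - x" a] by simp
    ultimately show ?thesis using semisimple_inter_perp[OF ss I] by blast
  qed
  then show ?thesis using x(1) by (auto simp: centralizer_def)
qed

end

section \<open>Contractions of tensors\<close>

lemma linear_comp_formal_extend:
  assumes F: "Vector_Spaces.linear s t F"
  shows "F (formal_extend s f x) = formal_extend t (\<lambda>i. F (f i)) x"
  unfolding formal_extend_def
  by (simp add: module_hom.sum[OF linear_hom[OF F]] module_hom.scale[OF linear_hom[OF F]])

lemma formal_extend_cong:
  "(\<And>i. i \<in> Poly_Mapping.keys x \<Longrightarrow> f i = g i) \<Longrightarrow> formal_extend s f x = formal_extend s g x"
  by (simp add: formal_extend_def)

lemma formal_extend_gen_self: "formal_extend formal_scale gen x = x"
proof (rule poly_mapping_eqI)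
  fix i
  have "Poly_Mapping.lookup (sum f A) i = (\<Sum>k\<in>A. Poly_Mapping.lookup (f k) i)"
    for f :: "'a \<Rightarrow> 'a \<Rightarrow>\<^sub>0 'b" and A
    by (induction A rule: infinite_finite_induct) (simp_all add: lookup_add)
  then have "Poly_Mapping.lookup (formal_extend formal_scale gen x) i =
      (\<Sum>k\<in>Poly_Mapping.keys x. Poly_Mapping.lookup x k * Poly_Mapping.lookup (gen k) i)"
    by (simp add: formal_extend_def)
  also have "\<dots> = (\<Sum>k\<in>Poly_Mapping.keys x. if k = i then Poly_Mapping.lookup x i else 0)"
    by (rule sum.cong) (auto simp: lookup_single when_def)
  finally show "Poly_Mapping.lookup (formal_extend formal_scale gen x) i = Poly_Mapping.lookup x i"
    by (simp add: in_keys_iff)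
qed

lemma tensor_null_sum:
  "(\<And>i. i \<in> A \<Longrightarrow> f i - g i \<in> tensor_null sV sW) \<Longrightarrow> sum f A - sum g A \<in> tensor_null sV sW"
  unfolding sum_subtractf[symmetric] by (rule formal.subspace_sum[OF subspace_tensor_null])

lemma tensor_null_trans:
  "x - y \<in> tensor_null sV sW \<Longrightarrow> y - z \<in> tensor_null sV sW \<Longrightarrow> x - z \<in> tensor_null sV sW"
  using formal.subspace_add[OF subspace_tensor_null, of "x - y" sV sW "y - z"] by simp

lemma gen_zero: "gen (0, w) \<in> tensor_null sV sW" "gen (v, 0) \<in> tensor_null sV sW"
  using tensor_relators_mem(1)[of 0 0 w sV sW] tensor_relators_mem(2)[of v 0 0 sV sW]
    formal.subspace_neg[OF subspace_tensor_null] by force+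

lemma gen_sum_left:
  fixes sV :: "'k::field \<Rightarrow> 'v::ab_group_add \<Rightarrow> 'v"
  assumes "finite A"
  shows "gen (\<Sum>i\<in>A. sV (c i) (v i), w) - (\<Sum>i\<in>A. formal_scale (c i) (gen (v i, w))) \<in> tensor_null sV sW"
  using assms
proof (induction A)
  case empty
  then show ?case by (simp add: gen_zero)
next
  case (insert i A)
  let ?s = "\<Sum>i\<in>A. sV (c i) (v i)" and ?t = "\<Sum>i\<in>A. formal_scale (c i) (gen (v i, w))"
  have "(gen (sV (c i) (v i) + ?s, w) - gen (sV (c i) (v i), w) - gen (?s, w))
      + (gen (sV (c i) (v i), w) - formal_scale (c i) (gen (v i, w))) + (gen (?s, w) - ?t) \<in> tensor_null sV sW"
    by (intro formal.subspace_add[OF subspace_tensor_null] tensor_relators_mem insert.IH)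
  then show ?case using insert.hyps by (simp add: algebra_simps)
qed

lemma gen_sum_right:
  fixes sW :: "'k::field \<Rightarrow> 'w::ab_group_add \<Rightarrow> 'w"
  assumes "finite A"
  shows "gen (v, \<Sum>i\<in>A. sW (c i) (w i)) - (\<Sum>i\<in>A. formal_scale (c i) (gen (v, w i))) \<in> tensor_null sV sW"
  using assms
proof (induction A)
  case empty
  then show ?case by (simp add: gen_zero)
next
  case (insert i A)
  let ?s = "\<Sum>i\<in>A. sW (c i) (w i)" and ?t = "\<Sum>i\<in>A. formal_scale (c i) (gen (v, w i))"
  have "(gen (v, sW (c i) (w i) + ?s) - gen (v, sW (c i) (w i)) - gen (v, ?s))
      + (gen (v, sW (c i) (w i)) - formal_scale (c i) (gen (v, w i))) + (gen (v, ?s) - ?t) \<in> tensor_null sV sW"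
    by (intro formal.subspace_add[OF subspace_tensor_null] tensor_relators_mem insert.IH)
  then show ?case using insert.hyps by (simp add: algebra_simps)
qed

text \<open>On representatives this is \<open>id \<otimes> \<psi>\<close>, with
  \<open>V \<otimes> k\<close> identified with \<open>V\<close>; \<open>contract_null\<close> gives
  independence of the representative.\<close>

definition contract ::
  "('k::field \<Rightarrow> 'v::ab_group_add \<Rightarrow> 'v) \<Rightarrow> ('w \<Rightarrow> 'k) \<Rightarrow> ('v \<times> 'w \<Rightarrow>\<^sub>0 'k) \<Rightarrow> 'v"
  where "contract sV \<psi> = formal_extend sV (\<lambda>(v, w). sV (\<psi> w) v)"

lemma contract_null:
  assumes V: "vector_space sV" and \<psi>: "Vector_Spaces.linear sW (*) \<psi>" and x: "x \<in> tensor_null sV sW"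
  shows "contract sV \<psi> x = 0"
proof -
  interpret V: vector_space sV by (rule V)
  note p = module_hom.add[OF linear_hom[OF \<psi>]] module_hom.scale[OF linear_hom[OF \<psi>]]
  have "contract sV \<psi> x \<in> {0}"
    unfolding contract_def
    by (rule tensor_null_induct[OF linear_hom[OF V.linear_formal_extend] V.subspace_single_0 _ _ _ _ x])
      (auto simp: p V.scale_left_distrib V.scale_right_distrib mult.commute)
  then show ?thesis by simp
qed

text \<open>For a basis of \<open>W\<close>, the tensor is the sum over basis vectors
  \<open>b\<close> of its contraction by the \<open>b\<close>-th coordinate functional, tensored
  with \<open>b\<close>; only finitely many \<open>b\<close> occur.\<close>

lemma tensor_subspace_if_contract_mem:
  fixes sV :: "'k::field \<Rightarrow> 'v::ab_group_add \<Rightarrow> 'v" and sW :: "'k \<Rightarrow> 'w::ab_group_add \<Rightarrow> 'w"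
  assumes V: "vector_space sV" and W: "vector_space sW"
    and mem: "\<And>\<psi>. Vector_Spaces.linear sW (*) \<psi> \<Longrightarrow> contract sV \<psi> x \<in> A"
  shows "tensor_class sV sW x \<in> tensor_subspace sV sW A UNIV"
proof -
  interpret V: vector_space sV by (rule V)
  interpret W: vector_space sW by (rule W)
  let ?B = "W.extend_basis {}"
  have B: "W.independent ?B" "W.span ?B = UNIV"
    using W.independent_extend_basis W.span_extend_basis W.independent_empty by blast+
  let ?r = "W.representation ?B"
  define K where "K = Poly_Mapping.keys x"
  define F where "F = (\<Union>(v, w)\<in>K. {b. ?r w b \<noteq> 0})"
  have K: "finite K" by (simp add: K_def)
  have F: "finite F"
    using K W.finite_representation[of ?B] by (auto simp: F_def)
  have rep: "w = (\<Sum>b\<in>F. sW (?r w b) b)" if "(v, w) \<in> K" for v w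
  proof -
    have "w = (\<Sum>b | ?r w b \<noteq> 0. sW (?r w b) b)"
      using W.sum_nonzero_representation_eq[OF B(1), of w] B(2) by simp
    also have "\<dots> = (\<Sum>b\<in>F. sW (?r w b) b)"
      using that by (intro sum.mono_neutral_left F) (auto simp: F_def)
    finally show ?thesis .
  qed
  let ?l = "Poly_Mapping.lookup x"
  let ?t = "\<lambda>b. \<lambda>(v, w). formal_scale (?l (v, w) * ?r w b) (gen (v, b))"
  have one: "(\<Sum>k\<in>K. formal_scale (?l k) (gen k)) = x"
    using formal_extend_gen_self[of x] by (simp add: formal_extend_def K_def)
  \<comment> \<open>The second factors are expanded in the basis.\<close>
  have two: "(\<Sum>k\<in>K. formal_scale (?l k) (gen k)) - (\<Sum>k\<in>K. \<Sum>b\<in>F. ?t b k) \<in> tensor_null sV sW"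
  proof (rule tensor_null_sum)
    fix k assume k: "k \<in> K"
    obtain v w where vw: "k = (v, w)" by (cases k)
    have "gen (v, w) - (\<Sum>b\<in>F. formal_scale (?r w b) (gen (v, b))) \<in> tensor_null sV sW"
      using gen_sum_right[OF F, where v = v and c = "?r w" and w = "\<lambda>b. b" and sW = sW] rep[of v w] k vw by simp
    from formal.subspace_scale[OF subspace_tensor_null this, of "?l k"]
    show "formal_scale (?l k) (gen k) - (\<Sum>b\<in>F. ?t b k) \<in> tensor_null sV sW"
      by (simp add: vw formal.scale_right_diff_distrib formal.scale_sum_right)
  qed
  \<comment> \<open>The first factors that belong to one basis vector \<open>b\<close> are
    collected.\<close>
  have three: "(\<Sum>b\<in>F. \<Sum>k\<in>K. ?t b k) - (\<Sum>b\<in>F. gen (contract sV (\<lambda>w. ?r w b) x, b)) \<in> tensor_null sV sW"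
  proof (rule tensor_null_sum)
    fix b
    have c: "contract sV (\<lambda>w. ?r w b) x = (\<Sum>k\<in>K. sV (?l k * ?r (snd k) b) (fst k))"
      by (simp add: contract_def formal_extend_def K_def case_prod_beta)
    have "- (gen (contract sV (\<lambda>w. ?r w b) x, b) - (\<Sum>k\<in>K. ?t b k)) \<in> tensor_null sV sW"
      unfolding c case_prod_beta prod.collapse
      by (intro formal.subspace_neg[OF subspace_tensor_null] gen_sum_left[OF K])
    then show "(\<Sum>k\<in>K. ?t b k) - gen (contract sV (\<lambda>w. ?r w b) x, b) \<in> tensor_null sV sW"
      by simp
  qed
  have swap: "(\<Sum>k\<in>K. \<Sum>b\<in>F. ?t b k) = (\<Sum>b\<in>F. \<Sum>k\<in>K. ?t b k)"
    by (rule sum.swap)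
  let ?y = "\<Sum>b\<in>F. gen (contract sV (\<lambda>w. ?r w b) x, b)"
  from tensor_null_trans[OF two[unfolded swap] three] have "x - ?y \<in> tensor_null sV sW"
    unfolding one .
  then have "tensor_class sV sW x = tensor_class sV sW ?y" by (simp only: tensor_class_eq_iff)
  moreover have "Poly_Mapping.keys (\<Sum>b\<in>F'. gen (contract sV (\<lambda>w. ?r w b) x, b)) \<subseteq> A \<times> UNIV"
    if "finite F'" for F'
    using that
  proof (induction F')
    case (insert b F')
    have "contract sV (\<lambda>w. ?r w b) x \<in> A"
      by (rule mem[OF W.linear_representation[OF B]])
    then have "Poly_Mapping.keys (gen (contract sV (\<lambda>w. ?r w b) x, b) :: _ \<Rightarrow>\<^sub>0 'k) \<subseteq> A \<times> UNIV"
      by simp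
    then show ?case
      using insert keys_add[of "gen (contract sV (\<lambda>w. ?r w b) x, b)"
          "\<Sum>b\<in>F'. gen (contract sV (\<lambda>w. ?r w b) x, b)"] by force
  qed simp
  ultimately show ?thesis using F unfolding tensor_subspace_def by blast
qed

lemma tensor3_null_induct:
  assumes hom: "module_hom formal_scale s F"
    and "\<And>u u' v w. F (gen (u + u', v, w)) = F (gen (u, v, w)) + F (gen (u', v, w))"
    and "\<And>u v v' w. F (gen (u, v + v', w)) = F (gen (u, v, w)) + F (gen (u, v', w))"
    and "\<And>u v w w'. F (gen (u, v, w + w')) = F (gen (u, v, w)) + F (gen (u, v, w'))"
    and "\<And>c u v w. F (gen (sU c u, v, w)) = s c (F (gen (u, v, w)))"
    and "\<And>c u v w. F (gen (u, sV c v, w)) = s c (F (gen (u, v, w)))"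
    and "\<And>c u v w. F (gen (u, v, sW c w)) = s c (F (gen (u, v, w)))"
    and x: "x \<in> tensor3_null sU sV sW"
  shows "F x = 0"
proof -
  interpret F: module_hom formal_scale s F by (rule hom)
  have "tensor3_relators sU sV sW \<subseteq> F -` {0}"
    unfolding tensor3_relators_def using assms(2-7) by (auto simp: F.diff F.scale)
  moreover have "formal.subspace (F -` {0})"
    using F.subspace_vimage[OF F.m2.subspace_single_0] .
  ultimately have "tensor3_null sU sV sW \<subseteq> F -` {0}"
    unfolding tensor3_null_def by (rule formal.span_minimal)
  then show ?thesis using x by auto
qed

section \<open>Centralizers of subcomodules\<close>

context comodule_lie_algebra
begin

lemma H_mult_linear:
  "Vector_Spaces.linear sH sH ((*) g)" "Vector_Spaces.linear sH sH (\<lambda>g. g * h)"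
  using H.mult_bilinear by (auto simp: bilinear_map_def)

lemmas H_mult_scale = module_hom.scale[OF linear_hom[OF H_mult_linear(1)]]
  module_hom.scale[OF linear_hom[OF H_mult_linear(2)]]

lemmas S_simps = module_hom.add[OF linear_hom[OF H.antipode_linear]]
  module_hom.scale[OF linear_hom[OF H.antipode_linear]]

lemma coaction_zero: "\<rho> 0 = tensor_class sL sH 0"
proof -
  have "\<rho> (sL 0 0) = tensor_scale sL sH 0 (\<rho> 0)"
    using coaction_linear unfolding linear_into_tensor_def by blast
  then show ?thesis by (simp add: tensor_scale_def)
qed

lemma coaction_class: "tensor_class sL sH (tensor_rep (\<rho> a)) = \<rho> a"
  using coaction_linear by (intro class_tensor_rep) (simp add: linear_into_tensor_def)

text \<open>The identity \<open>[c\<^sub>0, a] \<otimes> c\<^sub>1 = \<rho>([c, a\<^sub>0]) (1 \<otimes> S(a\<^sub>1))\<close> is compared after applying \<open>id \<otimes> \<psi>\<close>, where no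
  representatives are involved: \<open>G\<close> takes \<open>u \<otimes> h \<otimes> h'\<close> to \<open>\<psi>(c\<^sub>1 h S(h')) [c\<^sub>0, u]\<close> and is applied to the two
  sides of the coassociativity law for \<open>a\<close>.\<close>

lemma br_contract_coaction_zero:
  assumes I: "subcomodule I" and c: "c \<in> centralizer I" and \<psi>: "Vector_Spaces.linear sH (*) \<psi>"
    and a: "a \<in> I"
  shows "br (contract sL \<psi> (tensor_rep (\<rho> c))) a = 0"
proof -
  let ?c = "tensor_rep (\<rho> c)"
  note \<psi>s = module_hom.add[OF linear_hom[OF \<psi>]] module_hom.scale[OF linear_hom[OF \<psi>]]
  \<comment> \<open>In Sweedler notation \<open>L t u\<close> is
    \<open>\<psi>(c\<^sub>1 t) [c\<^sub>0, u]\<close>; the goal is \<open>L 1 a = 0\<close>.\<close>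
  define L where "L t u = formal_extend sL (\<lambda>(v, g). sL (\<psi> (g * t)) (br v u)) ?c" for t u
  have L_add: "L (t + t') u = L t u + L t' u" "L t (u + u') = L t u + L t u'" for t t' u u'
    unfolding L_def by (simp_all add: formal_extend_add_fun[symmetric] case_prod_unfold
        distrib_left \<psi>s br_simps scale_left_distrib scale_right_distrib)
  have L_scale: "L (sH k t) u = sL k (L t u)" "L t (sL k u) = sL k (L t u)" for k t u
    unfolding L_def by (simp_all add: formal_extend_scale_fun[symmetric] case_prod_unfold
        H_mult_scale \<psi>s br_simps mult.commute)
  have L_linear: "Vector_Spaces.linear sH sL (\<lambda>t. L t u)" for u
    by unfold_locales (simp_all add: L_add L_scale)
  have L_linear': "Vector_Spaces.linear sL sL (L t)" for t
    by unfold_locales (simp_all add: L_add L_scale)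
  have L_one: "L 1 u = br (contract sL \<psi> ?c) u" for u
    unfolding contract_def linear_comp_formal_extend[OF br_linear_left] L_def
    by (simp add: case_prod_unfold br_simps)
  define G where "G = formal_extend sL (\<lambda>(u, h, h'). L (h * S h') u)"
  have G_linear: "Vector_Spaces.linear formal_scale sL G"
    unfolding G_def by (rule linear_formal_extend)
  have G_gen: "G (gen (u, p)) = L (fst p * S (snd p)) u" for u p
    by (simp add: G_def case_prod_unfold)
  have G_null: "G y = 0" if "y \<in> tensor3_null sL sH sH" for y
    by (rule tensor3_null_induct[OF linear_hom[OF G_linear] _ _ _ _ _ _ that])
      (simp_all add: G_gen L_add L_scale distrib_left distrib_right S_simps H_mult_scale)
  \<comment> \<open>The chosen representative of \<open>\<rho> a\<close> need not have its first
    factors in \<open>I\<close>, so it is replaced by one that does; \<open>map_left_class\<close>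
    and \<open>map_right_class\<close> permit this.\<close>
  obtain x where x: "\<rho> a = tensor_class sL sH x" "Poly_Mapping.keys x \<subseteq> I \<times> UNIV"
    using I a by (auto simp: subcomodule_def tensor_subspace_def)
  have "tensor3_class sL sH sH (formal_map_left \<rho> x) = tensor3_class sL sH sH (formal_map_right \<Delta> x)"
    using coaction_coassoc[of a]
    unfolding x(1) map_left_class[OF coaction_linear] map_right_class[OF H.comult_linear] .
  then have "G (formal_map_left \<rho> x - formal_map_right \<Delta> x) = 0"
    unfolding tensor3_class_eq_iff by (rule G_null)
  then have eq: "G (formal_map_left \<rho> x) = G (formal_map_right \<Delta> x)"
    by (simp add: module_hom.diff[OF linear_hom[OF G_linear]])
  \<comment> \<open>As \<open>[c, b] = 0\<close>, this is the contraction of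
    \<open>\<rho>([c, b])\<close> by the functional sending \<open>t\<close> to
    \<open>\<psi>(t S(h'))\<close>.\<close>
  have left: "formal_extend sL (\<lambda>(u, h). L (h * S h') u) (tensor_rep (\<rho> b)) = 0" if b: "b \<in> I" for b h'
  proof -
    let ?b = "tensor_rep (\<rho> b)"
    have \<psi>': "Vector_Spaces.linear sH (*) (\<lambda>t. \<psi> (t * S h'))"
      using Vector_Spaces.linear_compose[OF H_mult_linear(2) \<psi>] by (simp add: o_def)
    have "tensor_class sL sH (formal_mult br (*) ?c ?b) = tensor_mult sL sH br (*) (\<rho> c) (\<rho> b)"
      by (simp add: tensor_mult_def)
    also have "\<dots> = \<rho> 0"
      using c b coaction_br[of c b] by (simp add: centralizer_def)
    finally have "formal_mult br (*) ?c ?b \<in> tensor_null sL sH"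
      unfolding coaction_zero tensor_class_eq_iff by simp
    then have "0 = contract sL (\<lambda>t. \<psi> (t * S h')) (formal_mult br (*) ?c ?b)"
      using contract_null[OF vector_space_axioms \<psi>'] by simp
    also have "\<dots> = formal_extend sL (\<lambda>(u, h). L (h * S h') u) ?b"
      unfolding formal_mult_swap contract_def linear_comp_formal_extend[OF linear_formal_extend]
        case_prod_unfold L_def
      by (simp add: linear_comp_formal_extend[OF linear_formal_extend] case_prod_unfold mult.assoc)
    finally show ?thesis by simp
  qed
  have "G (formal_map_left \<rho> x) =
      formal_extend sL (\<lambda>(b, h'). formal_extend sL (\<lambda>(u, h). L (h * S h') u) (tensor_rep (\<rho> b))) x"
    unfolding formal_map_left_def
    by (simp add: linear_comp_formal_extend[OF G_linear] case_prod_unfold G_gen)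
  also have "\<dots> = formal_extend sL (\<lambda>_. 0) x"
    by (rule formal_extend_cong) (use x(2) left in auto)
  finally have G_left: "G (formal_map_left \<rho> x) = 0" by (simp add: formal_extend_def)
  \<comment> \<open>The antipode axiom collapses \<open>h\<^sub>1 S(h\<^sub>2)\<close> to a multiple
    of 1; the counit axiom of the coaction then recovers \<open>a\<close>.\<close>
  have right: "formal_extend sL (\<lambda>(h, h'). L (h * S h') u) (tensor_rep (\<Delta> t)) = sL (\<epsilon> t) (L 1 u)" for u t
  proof -
    have "formal_extend sL (\<lambda>(h, h'). L (h * S h') u) (tensor_rep (\<Delta> t)) =
        L (tensor_lift sH (\<lambda>g g'. g * S g') (\<Delta> t)) u"
      unfolding tensor_lift_def linear_comp_formal_extend[OF L_linear] by (simp add: case_prod_unfold)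
    then show ?thesis by (simp add: H.antipode_right L_scale)
  qed
  have "G (formal_map_right \<Delta> x) = formal_extend sL (\<lambda>(u, t). sL (\<epsilon> t) (L 1 u)) x"
    unfolding formal_map_right_def
    by (simp add: linear_comp_formal_extend[OF G_linear] case_prod_unfold G_gen right[unfolded case_prod_unfold])
  also have "\<dots> = L 1 (formal_extend sL (\<lambda>(u, t). sL (\<epsilon> t) u) x)"
    unfolding linear_comp_formal_extend[OF L_linear'] by (simp add: case_prod_unfold L_scale)
  also have "formal_extend sL (\<lambda>(u, t). sL (\<epsilon> t) u) x = a"
  proof -
    note \<epsilon> = module_hom.add[OF linear_hom[OF H.counit_linear]] module_hom.scale[OF linear_hom[OF H.counit_linear]]
    have "bilinear_map sL sH sL (\<lambda>b h. sL (\<epsilon> h) b)"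
      unfolding bilinear_map_def
      by (intro conjI allI; unfold_locales)
        (simp_all add: \<epsilon> scale_left_distrib scale_right_distrib mult.commute)
    from tensor_lift_class[OF this, of x] show ?thesis
      using coaction_counit[of a] by (simp add: x(1))
  qed
  finally show ?thesis using eq L_one G_left by simp
qed

text \<open>All contractions of \<open>\<rho> c\<close> centralize \<open>I\<close>, which suffices
  by \<open>tensor_subspace_if_contract_mem\<close>.\<close>

lemma subcomodule_centralizer:
  assumes I: "subcomodule I"
  shows "subcomodule (centralizer I)"
  unfolding subcomodule_def
proof (intro conjI subspace_centralizer image_subsetI)
  fix c assume "c \<in> centralizer I"
  then have "contract sL \<psi> (tensor_rep (\<rho> c)) \<in> centralizer I"
    if "Vector_Spaces.linear sH (*) \<psi>" for \<psi>
    using br_contract_coaction_zero[OF I _ that] by (simp add: centralizer_def)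
  from tensor_subspace_if_contract_mem[OF vector_space_axioms H.vector_space_axioms this]
  show "\<rho> c \<in> tensor_subspace sL sH (centralizer I) UNIV"
    by (simp only: coaction_class)
qed

end

section \<open>Direct sums of minimal invariant ideals\<close>

text \<open>The encoding of \<open>direct_sum\<close> with a target \<open>T\<close> in place of
  \<open>UNIV\<close>, so that partial sums can occur in an induction.\<close>

definition direct_onto :: "'i set \<Rightarrow> ('i \<Rightarrow> 'l::ab_group_add set) \<Rightarrow> 'l set \<Rightarrow> bool"
  where "direct_onto J A T \<longleftrightarrow> bij_betw (\<lambda>f. \<Sum>i\<in>J. f i) (Pi\<^sub>E J A) T"

text \<open>The \<open>T\<close>-parts of two expansions of one vector differ by an element of
  \<open>M\<close>, hence agree; uniqueness within \<open>T\<close> does the rest.\<close>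

lemma (in vector_space) direct_onto_insert:
  assumes d: "direct_onto J A T" and J: "finite J" "j \<notin> J"
    and T: "subspace T" and M: "subspace M" and TM: "T \<inter> M = {0}"
  shows "direct_onto (insert j J) (A(j := M)) {x + y | x y. x \<in> T \<and> y \<in> M}"
proof -
  let ?B = "A(j := M)" and ?S = "\<lambda>f. \<Sum>i\<in>J. f i"
  have sum: "(\<Sum>i\<in>insert j J. f i) = ?S (restrict f J) + f j" for f
    using J by (simp add: add.commute)
  have mem: "restrict f J \<in> Pi\<^sub>E J A" "f j \<in> M" if "f \<in> Pi\<^sub>E (insert j J) ?B" for f
    using that J(2) by (auto simp: PiE_iff split: if_splits)
  have inj: "inj_on ?S (Pi\<^sub>E J A)"
    using d by (simp add: direct_onto_def bij_betw_def)
  have S: "?S g \<in> T" if "g \<in> Pi\<^sub>E J A" for g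
    using d that by (auto simp: direct_onto_def bij_betw_def)
  show ?thesis
    unfolding direct_onto_def bij_betw_def
  proof (intro conjI subset_antisym subsetI inj_onI)
    fix f g assume fg: "f \<in> Pi\<^sub>E (insert j J) ?B" "g \<in> Pi\<^sub>E (insert j J) ?B"
      and eq: "(\<Sum>i\<in>insert j J. f i) = (\<Sum>i\<in>insert j J. g i)"
    let ?d = "?S (restrict f J) - ?S (restrict g J)"
    have d': "?d = g j - f j" using eq unfolding sum by (simp add: algebra_simps)
    moreover have "?d \<in> T" by (intro subspace_diff T S mem(1) fg)
    moreover have "g j - f j \<in> M" by (intro subspace_diff M mem(2) fg)
    ultimately have "?d \<in> T \<inter> M" unfolding d' by blast
    then have 0: "?d = 0" "g j - f j = 0" unfolding TM d' by blast+
    then have "restrict f J = restrict g J"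
      by (intro inj_onD[OF inj _ mem(1)[OF fg(1)] mem(1)[OF fg(2)]]) (simp only: right_minus_eq)
    then have "f i = g i" if "i \<in> insert j J" for i
      using that 0(2) by (metis insertE restrict_apply' right_minus_eq)
    then show "f = g" using fg by (intro PiE_ext[of f "insert j J" ?B g]) auto
  next
    fix v assume "v \<in> (\<lambda>f. \<Sum>i\<in>insert j J. f i) ` Pi\<^sub>E (insert j J) ?B"
    then obtain f where f: "f \<in> Pi\<^sub>E (insert j J) ?B" "v = ?S (restrict f J) + f j"
      unfolding sum by blast
    then show "v \<in> {x + y | x y. x \<in> T \<and> y \<in> M}" using S mem by blast
  next
    fix v assume "v \<in> {x + y | x y. x \<in> T \<and> y \<in> M}"
    then obtain x y where v: "v = x + y" "x \<in> T" "y \<in> M" by blast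
    have "x \<in> ?S ` Pi\<^sub>E J A" using d v(2) by (simp add: direct_onto_def bij_betw_def)
    then obtain g where g: "g \<in> Pi\<^sub>E J A" "x = ?S g" by blast
    have "?S (g(j := y)) = ?S g" using J(2) by (intro sum.cong) auto
    then have "v = (\<Sum>i\<in>insert j J. (g(j := y)) i)"
      using J v(1) g(2) by (simp add: add.commute)
    moreover have "g(j := y) \<in> Pi\<^sub>E (insert j J) ?B"
      using g(1) v(3) J(2) by (auto simp: PiE_iff extensional_def split: if_splits)
    ultimately show "v \<in> (\<lambda>f. \<Sum>i\<in>insert j J. f i) ` Pi\<^sub>E (insert j J) ?B" by blast
  qed
qed

locale fd_comodule_lie_algebra =
  comodule_lie_algebra sH \<Delta> \<epsilon> S sL br \<rho> + fd_lie_algebra sL br Basis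
  for sH :: "'k::field_char_0 \<Rightarrow> 'h::ring_1 \<Rightarrow> 'h" and \<Delta> \<epsilon> S
    and sL :: "'k \<Rightarrow> 'l::ab_group_add \<Rightarrow> 'l" and br \<rho> Basis
begin

section \<open>Ideals that are subcomodules\<close>

definition H_ideal :: "'l set \<Rightarrow> bool"
  where "H_ideal I \<longleftrightarrow> lie_ideal UNIV I \<and> subcomodule I"

lemma H_ideal_subspace: "H_ideal I \<Longrightarrow> subspace I"
  by (simp add: H_ideal_def lie_ideal_def)

lemma H_ideal_zero: "H_ideal {0}"
  unfolding H_ideal_def lie_ideal_def subcomodule_def tensor_subspace_def
  by (auto simp: br_simps coaction_zero intro!: image_eqI[of _ _ 0])

lemma H_ideal_centralizer: "H_ideal I \<Longrightarrow> H_ideal (centralizer I)"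
  by (simp add: H_ideal_def lie_ideal_centralizer subcomodule_centralizer)

text \<open>Representatives of \<open>\<rho> x\<close> and \<open>\<rho> y\<close> with first
  factors in \<open>I\<close> and in \<open>K\<close> add up to one with first factors in the sum,
  which contains both.\<close>

lemma H_ideal_sum:
  assumes I: "H_ideal I" and K: "H_ideal K"
  shows "H_ideal {x + y | x y. x \<in> I \<and> y \<in> K}" (is "H_ideal ?S")
proof -
  note sub = H_ideal_subspace[OF I] H_ideal_subspace[OF K]
  have S: "subspace ?S" by (rule subspace_sums[OF sub])
  have "br a (x + y) \<in> ?S" if "x \<in> I" "y \<in> K" for a x y
  proof -
    have "br a x \<in> I" "br a y \<in> K"
      using that I K by (auto simp: H_ideal_def lie_ideal_def)
    then show ?thesis unfolding br_simps(1) by blast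
  qed
  then have "lie_ideal UNIV ?S"
    unfolding lie_ideal_def using S by blast
  moreover have "\<rho> (x + y) \<in> tensor_subspace sL sH ?S UNIV" if xy: "x \<in> I" "y \<in> K" for x y
  proof -
    have "\<rho> x \<in> tensor_subspace sL sH I UNIV" "\<rho> y \<in> tensor_subspace sL sH K UNIV"
      using I K xy unfolding H_ideal_def subcomodule_def by blast+
    then obtain p q where p: "\<rho> x = tensor_class sL sH p" "Poly_Mapping.keys p \<subseteq> I \<times> UNIV"
      and q: "\<rho> y = tensor_class sL sH q" "Poly_Mapping.keys q \<subseteq> K \<times> UNIV"
      unfolding tensor_subspace_def by blast
    have "\<rho> (x + y) = tensor_add sL sH (\<rho> x) (\<rho> y)"
      using coaction_linear unfolding linear_into_tensor_def by blast
    then have "\<rho> (x + y) = tensor_class sL sH (p + q)"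
      unfolding p(1) q(1) tensor_add_class .
    moreover have "I \<subseteq> ?S" "K \<subseteq> ?S"
      using subspace_0[OF sub(1)] subspace_0[OF sub(2)] by force+
    then have "Poly_Mapping.keys (p + q) \<subseteq> ?S \<times> UNIV"
      using keys_add[of p q] p(2) q(2) by blast
    ultimately show ?thesis unfolding tensor_subspace_def by blast
  qed
  then have "subcomodule ?S" unfolding subcomodule_def using S by blast
  ultimately show ?thesis by (simp add: H_ideal_def)
qed

lemma minimal_H_ideal_exists:
  assumes "H_ideal J" "J \<noteq> {0}"
  shows "\<exists>M\<subseteq>J. H_ideal M \<and> M \<noteq> {0} \<and> (\<forall>I\<subseteq>M. H_ideal I \<longrightarrow> I = {0} \<or> I = M)"
  using assms
proof (induction "dim J" arbitrary: J rule: less_induct)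
  case less
  show ?case
  proof (cases "\<forall>I\<subseteq>J. H_ideal I \<longrightarrow> I = {0} \<or> I = J")
    case True
    then show ?thesis using less.prems by blast
  next
    case False
    then obtain I where I: "I \<subseteq> J" "H_ideal I" "I \<noteq> {0}" "I \<noteq> J" by blast
    have "dim I < dim J"
    proof (rule ccontr)
      assume "\<not> dim I < dim J"
      then have "I = J"
        by (intro subspace_dim_equal H_ideal_subspace I less.prems) simp
      then show False using I(4) by simp
    qed
    from less.hyps[OF this I(2,3)] show ?thesis using I(1) by blast
  qed
qed

lemma minimal_H_ideal_H_simple:
  assumes ss: semisimple and M: "H_ideal M" and min: "\<And>I. I \<subseteq> M \<Longrightarrow> H_ideal I \<Longrightarrow> I = {0} \<or> I = M"
  shows "H_simple M"
proof -
  have Mi: "lie_ideal UNIV M" using M by (simp add: H_ideal_def)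
  have "I = {0} \<or> I = M" if I: "lie_ideal M I" "subcomodule I" for I
  proof (rule min)
    show IM: "I \<subseteq> M" using I(1) by (simp add: lie_ideal_def)
    have "br v y \<in> I" if y: "y \<in> I" for v y
    proof -
      obtain x where x: "x \<in> M" "v - x \<in> centralizer M"
        using semisimple_decompose[OF ss Mi] by blast
      have "br (v - x) y = 0" using x(2) y IM by (auto simp: centralizer_def)
      then have "br v y = br x y" by (simp add: br_simps)
      then show ?thesis using I(1) x(1) y by (simp add: lie_ideal_def)
    qed
    then show "H_ideal I" using I by (auto simp: H_ideal_def lie_ideal_def)
  qed
  then show ?thesis
    using M lie_ideal_subalgebra[OF Mi] by (simp add: H_simple_def H_ideal_def)
qed

text \<open>Induction on a lower bound \<open>k\<close> for the dimension of the part
  \<open>T\<close> decomposed so far; a minimal invariant ideal inside the centralizer of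
  \<open>T\<close> is the next summand.\<close>

lemma H_simple_direct_sum_dim:
  assumes ss: semisimple
  shows "\<exists>(s::nat) B T. (\<forall>i\<in>{1..s}. H_ideal (B i) \<and> H_simple (B i)) \<and> H_ideal T \<and>
    direct_onto {1..s} B T \<and> (T = UNIV \<or> k \<le> dim T)"
proof (induction k)
  case 0
  \<comment> \<open>The empty product has exactly one element, and its empty sum is 0.\<close>
  have "direct_onto {1..0::nat} (\<lambda>_. {}) ({0} :: 'l set)"
    by (auto simp: direct_onto_def bij_betw_def)
  then show ?case using H_ideal_zero by (intro exI[of _ 0] exI[of _ "\<lambda>_. {}"] exI[of _ "{0}"]) simp
next
  case (Suc k)
  then obtain s :: nat and B T where B: "\<And>i. i \<in> {1..s} \<Longrightarrow> H_ideal (B i) \<and> H_simple (B i)"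
    and T: "H_ideal T" and dir: "direct_onto {1..s} B T" and k: "T = UNIV \<or> k \<le> dim T"
    by blast
  show ?case
  proof (cases "T = UNIV")
    case True
    then show ?thesis using B T dir by blast
  next
    case False
    have Ti: "lie_ideal UNIV T" using T by (simp add: H_ideal_def)
    \<comment> \<open>With a trivial centralizer, \<open>semisimple_decompose\<close> would put
      every vector into \<open>T\<close>.\<close>
    have "centralizer T \<noteq> {0}"
    proof
      assume z: "centralizer T = {0}"
      have "v \<in> T" for v
        using semisimple_decompose[OF ss Ti, of v] unfolding z by auto
      then show False using False by blast
    qed
    then obtain M where M: "M \<subseteq> centralizer T" "H_ideal M" "M \<noteq> {0}"
      and min: "\<And>I. I \<subseteq> M \<Longrightarrow> H_ideal I \<Longrightarrow> I = {0} \<or> I = M"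
      using minimal_H_ideal_exists[OF H_ideal_centralizer[OF T]] by blast
    note sub = H_ideal_subspace[OF T] H_ideal_subspace[OF M(2)]
    have TM: "T \<inter> M = {0}"
      using semisimple_inter_centralizer[OF ss Ti] M(1) subspace_0[OF sub(1)] subspace_0[OF sub(2)]
      by blast
    let ?S = "{x + y | x y. x \<in> T \<and> y \<in> M}"
    have S: "H_ideal ?S" by (rule H_ideal_sum[OF T M(2)])
    have incl: "T \<subseteq> ?S" "M \<subseteq> ?S"
      using subspace_0[OF sub(1)] subspace_0[OF sub(2)] by force+
    have "dim T < dim ?S"
    proof (rule ccontr)
      assume "\<not> dim T < dim ?S"
      then have "T = ?S"
        by (intro subspace_dim_equal H_ideal_subspace T S incl) simp
      then have "M \<subseteq> {0}" using incl(2) TM by blast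
      then show False using M(3) subspace_0[OF sub(2)] by blast
    qed
    then have "Suc k \<le> dim ?S" using k False by simp
    moreover have "{1..Suc s} = insert (Suc s) {1..s}" by auto
    then have "direct_onto {1..Suc s} (B(Suc s := M)) ?S"
      using direct_onto_insert[OF dir _ _ sub TM, of "Suc s"] by simp
    moreover have "H_ideal ((B(Suc s := M)) i) \<and> H_simple ((B(Suc s := M)) i)" if "i \<in> {1..Suc s}" for i
      using that B M(2) minimal_H_ideal_H_simple[OF ss M(2) min] by (cases "i = Suc s") auto
    ultimately show ?thesis using S by blast
  qed
qed

lemma semisimple_direct_sum_H_simple:
  assumes semisimple
  shows "\<exists>(s::nat) B. (\<forall>i\<in>{1..s}. lie_ideal UNIV (B i) \<and> subcomodule (B i) \<and> H_simple (B i)) \<and>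
    direct_sum {1..s} B"
proof -
  \<comment> \<open>No subspace has dimension \<open>Suc dimension\<close>, so this bound leaves
    only \<open>T = UNIV\<close>.\<close>
  obtain s :: nat and B T where B: "\<forall>i\<in>{1..s}. H_ideal (B i) \<and> H_simple (B i)"
    and dir: "direct_onto {1..s} B T" and T: "T = UNIV \<or> Suc dimension \<le> dim T"
    using H_simple_direct_sum_dim[OF assms, of "Suc dimension"] by blast
  have "dim T \<le> dimension" by (rule dim_subset_UNIV)
  then have "T = UNIV" using T by simp
  then have "direct_sum {1..s} B" using dir by (simp add: direct_onto_def Defs.direct_sum_def)
  then show ?thesis using B unfolding H_ideal_def by blast
qed

end

theorem theorem7:
  fixes sH :: "'k::field_char_0 \<Rightarrow> 'h::ring_1 \<Rightarrow> 'h"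
    and \<Delta> :: "'h \<Rightarrow> ('h, 'h, 'k) tensor"
    and \<epsilon> :: "'h \<Rightarrow> 'k"
    and S :: "'h \<Rightarrow> 'h"
    and sB :: "'k \<Rightarrow> 'b::ab_group_add \<Rightarrow> 'b"
    and br :: "'b \<Rightarrow> 'b \<Rightarrow> 'b"
    and \<rho> :: "'b \<Rightarrow> ('b, 'h, 'k) tensor"
  assumes "hopf_algebra sH \<Delta> \<epsilon> S"
    and "lie_algebra sB br"
    and "\<exists>Basis. finite_dimensional_vector_space sB Basis"
    and "lie_algebra.semisimple sB br"
    and "comodule_lie_algebra sH \<Delta> \<epsilon> S sB br \<rho>"
  shows "\<exists>(s::nat) (B :: nat \<Rightarrow> 'b set).
    (\<forall>i\<in>{1..s}. lie_algebra.lie_ideal sB br UNIV (B i)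
      \<and> comodule_lie_algebra.subcomodule sH sB \<rho> (B i)
      \<and> comodule_lie_algebra.H_simple sH sB br \<rho> (B i))
    \<and> direct_sum {1..s} B"
proof -
  obtain Basis where "finite_dimensional_vector_space sB Basis"
    using assms(3) by blast
  then interpret fd_comodule_lie_algebra sH \<Delta> \<epsilon> S sB br \<rho> Basis
    using assms(2,5)
    by (simp add: fd_comodule_lie_algebra_def fd_lie_algebra_def)
  show ?thesis by (rule semisimple_direct_sum_H_simple[OF assms(4)])
qed

end
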